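(* Let $\mathcal{C}$ be a $\mathbb{C}$-linear abelian rigid monoidal category with a linear-simple unit object $\mathbf{1}$ and a quasi-pivotal structure $\phi$. Let $X$ be a finite-length connected Frobenius algebra in $\mathcal{C}$ that is $\phi_X$-weakly positive, where $\phi_X$ is an algebra isomorphism, and suppose that $\mathrm{End}_{\mathcal{C}}(X)$ is finite-dimensional. Then every coherent sublattice of the Frobenius subalgebra poset of $X$ is finite.
   Context: Monoidal categories are taken strict. A left dual of $X$ is $(X^*,\mathrm{ev}_X:X^*\otimes X\to\mathbf 1,\mathrm{coev}_X:\mathbf 1\to X\otimes X^* )$ satisfying the zigzag identities; $f^*:Y^*\to X^*$ is the dual of $f:X\to Y$. Linear-simple unit: $\mathrm{Hom}(\mathbf 1,\mathbf 1)=\mathbb{C}$. A Frobenius algebra is $(X,m,\delta,e,\epsilon)$ with $(X,m,e)$ a unital algebra, $(X,\delta,\epsilon)$ a counital coalgebra and $(\mathrm{id}_X\otimes m)\circ(\delta\otimes \mathrm{id}_X)=\delta\circ m=(m\otimes \mathrm{id}_X)\circ(\mathrm{id}_X\otimes\delta)$. It is always regarded as selfdual, $X^*=X$ (hence $X^{**}=X$), with $\mathrm{ev}_X=\epsilon\circ m$, $\mathrm{coev}_X=\delta\circ e$. $X$ is connected if $\dim\mathrm{Hom}(\mathbf 1,X)=1$. Quasi-pivotal structure: a natural isomorphism $\phi:\mathrm{id}_{\mathcal C}\to(\,)^{**}$, i.e. isomorphisms $\phi_Y:Y\to Y^{**}$ with $f=\phi_Z^{-1}\circ f^{**}\circ\phi_Y$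 for all $f:Y\to Z$ (no monoidality required). For $\alpha:X\to X^{**}$, $\mathrm{tr}(\alpha):=\mathrm{ev}_{X^*}\circ(\alpha\otimes\mathrm{id}_{X^*})\circ\mathrm{coev}_X\in\mathrm{End}(\mathbf 1)=\mathbb{C}$. $X$ is $\phi_X$-weakly positive if $\mathrm{tr}(\phi_X\circ b)>0$ for every nonzero idempotent $b\in\mathrm{End}_{\mathcal C}(X)$. "$\phi_X$ is an algebra isomorphism" means $\phi_X:X\to X^{**}=X$ satisfies $m\circ(\phi_X\otimes\phi_X)=\phi_X\circ m$. A Frobenius algebra $X'$ is a Frobenius subalgebra of $X$ if there is a unital algebra monomorphism $i:X'\to X$ with $i^{**}=i$, $i^*\circ i=\mathrm{id}_{X'}$; put $b_{X'}:=i\circ i^*$. Two Frobenius subalgebras are equivalent iff their idempotents $b$ coincide; classes are denoted $[X']$; the Frobenius subalgebra poset of $X$ is the set of classes with $[X_1]\le[X_2]$ iff $b_{X_1}\circ b_{X_2}=b_{X_1}=b_{X_2}\circ b_{X_1}$. Ambient selfduality: let $C=C^*$ be selfdual and $(B,i,p)$ a split subobject ($p\circ i=\mathrm{id}_B$), $b=i\circ p$. Split $b^*=i'\circ p'$, $p'\circ i'=\mathrm{id}_{B'}$; the ambient dual of $B$ is $(B',\mathrm{ev}_C\circ(i'\otimes i),(p\otimes p')\circ\mathrm{coev}_C)$ (then $i^*=p'$, $p^*=i'$). $B$ is ambiently selfdual if it coincides with its ambient dual, i.e. one may take $B'=B$, $i'=i$, $p'=p$ (so $i^*=p$, $i^{**}=p^*=i$).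 A pair $(A,B)$ of subobjects of $X$ is coherent if $A$, $B$, $A\cap B$ (pullback) and $A+B$ (the join in the lattice of subobjects of $X$) are all ambiently selfdual subobjects of $X$. A sublattice $L$ of the Frobenius subalgebra poset is coherent if it has a bottom element and for all $[A],[B]\in L$ the pair $(A,B)$ is coherent and $[A]\wedge[B]=[A\cap B]$. *)

theory Defs
  imports "Jordan_Normal_Form.VS_Connect" "HOL-Algebra.Lattice"
begin

section \<open>Linear abelian categories\<close>

text \<open>Arrows carry their source and target, so hom-sets are disjoint.  The operations of the record
  are only constrained on objects in \<open>obj\<close> and arrows in \<open>arr\<close>.\<close>

record ('o, 'a) lin_moncat =
  obj :: "'o set"
  arr :: "'a set"
  src :: "'a \<Rightarrow> 'o"
  tgt :: "'a \<Rightarrow> 'o"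
  idm :: "'o \<Rightarrow> 'a"
  cmp :: "'a \<Rightarrow> 'a \<Rightarrow> 'a"  (infixr \<open>\<cdot>\<index>\<close> 55)
  zarr :: "'o \<Rightarrow> 'o \<Rightarrow> 'a"
  padd :: "'a \<Rightarrow> 'a \<Rightarrow> 'a"
  scal :: "complex \<Rightarrow> 'a \<Rightarrow> 'a"
  unt :: 'o
  tobj :: "'o \<Rightarrow> 'o \<Rightarrow> 'o"  (infixr \<open>\<boxtimes>\<^sub>o\<index>\<close> 75)
  tarr :: "'a \<Rightarrow> 'a \<Rightarrow> 'a"  (infixr \<open>\<boxtimes>\<index>\<close> 75)

definition hom :: "('o, 'a) lin_moncat \<Rightarrow> 'o \<Rightarrow> 'o \<Rightarrow> 'a set" where
  "hom C X Y = {f \<in> arr C. src C f = X \<and> tgt C f = Y}"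

definition hom_space :: "('o, 'a) lin_moncat \<Rightarrow> 'o \<Rightarrow> 'o \<Rightarrow> (complex, 'a) module" where
  "hom_space C X Y =
     \<lparr> carrier = hom C X Y, mult = undefined, one = undefined,
       zero = zarr C X Y, add = padd C, smult = scal C \<rparr>"

locale category =
  fixes C :: "('o, 'a) lin_moncat" (structure)
  assumes src_obj: "f \<in> arr C \<Longrightarrow> src C f \<in> obj C"
    and tgt_obj: "f \<in> arr C \<Longrightarrow> tgt C f \<in> obj C"
    and idm_hom: "X \<in> obj C \<Longrightarrow> idm C X \<in> hom C X X"
    and cmp_hom: "f \<in> hom C X Y \<Longrightarrow> g \<in> hom C Y Z \<Longrightarrow> g \<cdot> f \<in> hom C X Z"
    and cmp_idm_left: "f \<in> hom C X Y \<Longrightarrow> idm C Y \<cdot> f = f"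
    and cmp_idm_right: "f \<in> hom C X Y \<Longrightarrow> f \<cdot> idm C X = f"
    and cmp_assoc: "f \<in> hom C W X \<Longrightarrow> g \<in> hom C X Y \<Longrightarrow> h \<in> hom C Y Z
                      \<Longrightarrow> (h \<cdot> g) \<cdot> f = h \<cdot> (g \<cdot> f)"

locale linear_category = category +
  assumes hom_vectorspace:
      "X \<in> obj C \<Longrightarrow> Y \<in> obj C \<Longrightarrow> vectorspace class_ring (hom_space C X Y)"
    and cmp_linear_left: "f \<in> hom C X Y \<Longrightarrow> Z \<in> obj C \<Longrightarrow>
      linear_map class_ring (hom_space C Y Z) (hom_space C X Z) (\<lambda>g. g \<cdot> f)"
    and cmp_linear_right: "g \<in> hom C Y Z \<Longrightarrow> X \<in> obj C \<Longrightarrow>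
      linear_map class_ring (hom_space C X Y) (hom_space C X Z) (\<lambda>f. g \<cdot> f)"

definition mono_arr :: "('o, 'a) lin_moncat \<Rightarrow> 'a \<Rightarrow> bool" where
  "mono_arr C f \<longleftrightarrow> f \<in> arr C \<and>
     (\<forall>W. \<forall>g \<in> hom C W (src C f). \<forall>h \<in> hom C W (src C f). cmp C f g = cmp C f h \<longrightarrow> g = h)"

definition epi_arr :: "('o, 'a) lin_moncat \<Rightarrow> 'a \<Rightarrow> bool" where
  "epi_arr C f \<longleftrightarrow> f \<in> arr C \<and>
     (\<forall>Z. \<forall>g \<in> hom C (tgt C f) Z. \<forall>h \<in> hom C (tgt C f) Z. cmp C g f = cmp C h f \<longrightarrow> g = h)"

definition iso_arr :: "('o, 'a) lin_moncat \<Rightarrow> 'a \<Rightarrow> bool" where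
  "iso_arr C f \<longleftrightarrow> f \<in> arr C \<and>
     (\<exists>g \<in> hom C (tgt C f) (src C f).
        cmp C g f = idm C (src C f) \<and> cmp C f g = idm C (tgt C f))"

definition zero_object :: "('o, 'a) lin_moncat \<Rightarrow> 'o \<Rightarrow> bool" where
  "zero_object C Z \<longleftrightarrow> Z \<in> obj C \<and>
     (\<forall>X \<in> obj C. (\<exists>!f. f \<in> hom C X Z) \<and> (\<exists>!f. f \<in> hom C Z X))"

definition is_biproduct ::
  "('o, 'a) lin_moncat \<Rightarrow> 'o \<Rightarrow> 'o \<Rightarrow> 'o \<Rightarrow> 'a \<Rightarrow> 'a \<Rightarrow> 'a \<Rightarrow> 'a \<Rightarrow> bool" where
  "is_biproduct C X Y S i j p q \<longleftrightarrow>
     i \<in> hom C X S \<and> j \<in> hom C Y S \<and> p \<in> hom C S X \<and> q \<in> hom C S Y \<and>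
     cmp C p i = idm C X \<and> cmp C q j = idm C Y \<and>
     cmp C q i = zarr C X Y \<and> cmp C p j = zarr C Y X \<and>
     padd C (cmp C i p) (cmp C j q) = idm C S"

definition is_kernel :: "('o, 'a) lin_moncat \<Rightarrow> 'a \<Rightarrow> 'a \<Rightarrow> bool" where
  "is_kernel C f k \<longleftrightarrow> f \<in> arr C \<and> k \<in> arr C \<and> tgt C k = src C f \<and>
     cmp C f k = zarr C (src C k) (tgt C f) \<and>
     (\<forall>W. \<forall>h \<in> hom C W (src C f). cmp C f h = zarr C W (tgt C f) \<longrightarrow>
        (\<exists>!u. u \<in> hom C W (src C k) \<and> cmp C k u = h))"

definition is_cokernel :: "('o, 'a) lin_moncat \<Rightarrow> 'a \<Rightarrow> 'a \<Rightarrow> bool" where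
  "is_cokernel C f q \<longleftrightarrow> f \<in> arr C \<and> q \<in> arr C \<and> src C q = tgt C f \<and>
     cmp C q f = zarr C (src C f) (tgt C q) \<and>
     (\<forall>Z. \<forall>h \<in> hom C (tgt C f) Z. cmp C h f = zarr C (src C f) Z \<longrightarrow>
        (\<exists>!u. u \<in> hom C (tgt C q) Z \<and> cmp C u q = h))"

locale abelian_category = linear_category +
  assumes ex_zero_object: "\<exists>Z. zero_object C Z"
    and ex_biproduct: "X \<in> obj C \<Longrightarrow> Y \<in> obj C \<Longrightarrow> \<exists>S i j p q. is_biproduct C X Y S i j p q"
    and ex_kernel: "f \<in> arr C \<Longrightarrow> \<exists>k. is_kernel C f k"
    and ex_cokernel: "f \<in> arr C \<Longrightarrow> \<exists>q. is_cokernel C f q"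
    and mono_is_kernel: "mono_arr C k \<Longrightarrow> \<exists>f. is_kernel C f k"
    and epi_is_cokernel: "epi_arr C q \<Longrightarrow> \<exists>f. is_cokernel C f q"

definition simple_object :: "('o, 'a) lin_moncat \<Rightarrow> 'o \<Rightarrow> bool" where
  "simple_object C S \<longleftrightarrow> S \<in> obj C \<and> \<not> zero_object C S \<and>
     (\<forall>k. mono_arr C k \<and> tgt C k = S \<longrightarrow> zero_object C (src C k) \<or> iso_arr C k)"

text \<open>A composition series \<open>0 = Y 0 \<rightarrow> Y 1 \<rightarrow> \<dots> \<rightarrow> Y n = X\<close> of monomorphisms with simple quotients.\<close>

definition finite_length :: "('o, 'a) lin_moncat \<Rightarrow> 'o \<Rightarrow> bool" where
  "finite_length C X \<longleftrightarrow> (\<exists>(n::nat) Y u. zero_object C (Y 0) \<and> Y n = X \<and>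
     (\<forall>k<n. u k \<in> hom C (Y k) (Y (Suc k)) \<and> mono_arr C (u k) \<and>
        (\<exists>q. is_cokernel C (u k) q \<and> simple_object C (tgt C q))))"


section \<open>Strict monoidal structure and duals\<close>

locale linear_monoidal_category = linear_category +
  assumes unt_obj: "unt C \<in> obj C"
    and tobj_obj: "X \<in> obj C \<Longrightarrow> Y \<in> obj C \<Longrightarrow> X \<boxtimes>\<^sub>o Y \<in> obj C"
    and tarr_hom: "f \<in> hom C X Y \<Longrightarrow> g \<in> hom C X' Y' \<Longrightarrow> f \<boxtimes> g \<in> hom C (X \<boxtimes>\<^sub>o X') (Y \<boxtimes>\<^sub>o Y')"
    and tobj_assoc: "X \<in> obj C \<Longrightarrow> Y \<in> obj C \<Longrightarrow> Z \<in> obj C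
                       \<Longrightarrow> (X \<boxtimes>\<^sub>o Y) \<boxtimes>\<^sub>o Z = X \<boxtimes>\<^sub>o (Y \<boxtimes>\<^sub>o Z)"
    and tobj_unt_left: "X \<in> obj C \<Longrightarrow> unt C \<boxtimes>\<^sub>o X = X"
    and tobj_unt_right: "X \<in> obj C \<Longrightarrow> X \<boxtimes>\<^sub>o unt C = X"
    and tarr_assoc: "f \<in> arr C \<Longrightarrow> g \<in> arr C \<Longrightarrow> h \<in> arr C
                       \<Longrightarrow> (f \<boxtimes> g) \<boxtimes> h = f \<boxtimes> (g \<boxtimes> h)"
    and tarr_unt_left: "f \<in> arr C \<Longrightarrow> idm C (unt C) \<boxtimes> f = f"
    and tarr_unt_right: "f \<in> arr C \<Longrightarrow> f \<boxtimes> idm C (unt C) = f"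
    and tarr_idm: "X \<in> obj C \<Longrightarrow> Y \<in> obj C \<Longrightarrow> idm C X \<boxtimes> idm C Y = idm C (X \<boxtimes>\<^sub>o Y)"
    and interchange: "f \<in> hom C X Y \<Longrightarrow> g \<in> hom C Y Z \<Longrightarrow> f' \<in> hom C X' Y' \<Longrightarrow> g' \<in> hom C Y' Z'
                       \<Longrightarrow> (g \<cdot> f) \<boxtimes> (g' \<cdot> f') = (g \<boxtimes> g') \<cdot> (f \<boxtimes> f')"
    and tarr_linear_left: "f \<in> hom C X' Y' \<Longrightarrow> X \<in> obj C \<Longrightarrow> Y \<in> obj C \<Longrightarrow>
      linear_map class_ring (hom_space C X Y) (hom_space C (X \<boxtimes>\<^sub>o X') (Y \<boxtimes>\<^sub>o Y')) (\<lambda>g. g \<boxtimes> f)"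
    and tarr_linear_right: "f \<in> hom C X Y \<Longrightarrow> X' \<in> obj C \<Longrightarrow> Y' \<in> obj C \<Longrightarrow>
      linear_map class_ring (hom_space C X' Y') (hom_space C (X \<boxtimes>\<^sub>o X') (Y \<boxtimes>\<^sub>o Y')) (\<lambda>g. f \<boxtimes> g)"

record ('o, 'a) dual_datum =
  dobj :: 'o
  dev :: 'a
  dcoev :: 'a

definition is_left_dual :: "('o, 'a) lin_moncat \<Rightarrow> 'o \<Rightarrow> ('o, 'a) dual_datum \<Rightarrow> bool" where
  "is_left_dual C X d \<longleftrightarrow> X \<in> obj C \<and> dobj d \<in> obj C \<and>
     dev d \<in> hom C (tobj C (dobj d) X) (unt C) \<and>
     dcoev d \<in> hom C (unt C) (tobj C X (dobj d)) \<and>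
     cmp C (tarr C (idm C X) (dev d)) (tarr C (dcoev d) (idm C X)) = idm C X \<and>
     cmp C (tarr C (dev d) (idm C (dobj d))) (tarr C (idm C (dobj d)) (dcoev d)) = idm C (dobj d)"

locale abelian_rigid_monoidal_category = abelian_category + linear_monoidal_category +
  assumes ex_left_dual: "X \<in> obj C \<Longrightarrow> \<exists>d. is_left_dual C X d"
    and ex_right_dual: "X \<in> obj C \<Longrightarrow> \<exists>Y d. is_left_dual C Y d \<and> dobj d = X"

definition linear_simple_unit :: "('o, 'a) lin_moncat \<Rightarrow> bool" where
  "linear_simple_unit C \<longleftrightarrow>
     (\<forall>f \<in> hom C (unt C) (unt C). \<exists>!z. f = scal C z (idm C (unt C)))"

text \<open>For \<open>f : X \<rightarrow> Y\<close> the dual \<open>f\<^sup>* : Y\<^sup>* \<rightarrow> X\<^sup>*\<close> depends on the dual data \<open>dX\<close>, \<open>dY\<close> chosen for the source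
  and the target, which are passed in this order.\<close>

definition dual_arr ::
  "('o, 'a) lin_moncat \<Rightarrow> ('o, 'a) dual_datum \<Rightarrow> ('o, 'a) dual_datum \<Rightarrow> 'a \<Rightarrow> 'a" where
  "dual_arr C dX dY f =
     cmp C (tarr C (dev dY) (idm C (dobj dX)))
       (cmp C (tarr C (idm C (dobj dY)) (tarr C f (idm C (dobj dX))))
         (tarr C (idm C (dobj dY)) (dcoev dX)))"

text \<open>In the following, \<open>D\<close> is a choice of a left dual for every object.\<close>

definition ddual_obj :: "('o \<Rightarrow> ('o, 'a) dual_datum) \<Rightarrow> 'o \<Rightarrow> 'o" where
  "ddual_obj D Y = dobj (D (dobj (D Y)))"

definition ddual_arr ::
  "('o, 'a) lin_moncat \<Rightarrow> ('o \<Rightarrow> ('o, 'a) dual_datum) \<Rightarrow> 'a \<Rightarrow> 'a" where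
  "ddual_arr C D f =
     dual_arr C (D (dobj (D (tgt C f)))) (D (dobj (D (src C f))))
       (dual_arr C (D (src C f)) (D (tgt C f)) f)"

definition quasi_pivotal ::
  "('o, 'a) lin_moncat \<Rightarrow> ('o \<Rightarrow> ('o, 'a) dual_datum) \<Rightarrow> ('o \<Rightarrow> 'a) \<Rightarrow> bool" where
  "quasi_pivotal C D \<phi> \<longleftrightarrow>
     (\<forall>Y \<in> obj C. is_left_dual C Y (D Y)) \<and>
     (\<forall>Y \<in> obj C. \<phi> Y \<in> hom C Y (ddual_obj D Y) \<and> iso_arr C (\<phi> Y)) \<and>
     (\<forall>f \<in> arr C. cmp C (\<phi> (tgt C f)) f = cmp C (ddual_arr C D f) (\<phi> (src C f)))"

definition tr ::
  "('o, 'a) lin_moncat \<Rightarrow> ('o \<Rightarrow> ('o, 'a) dual_datum) \<Rightarrow> 'o \<Rightarrow> 'a \<Rightarrow> 'a" where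
  "tr C D X \<alpha> =
     cmp C (dev (D (dobj (D X))))
       (cmp C (tarr C \<alpha> (idm C (dobj (D X)))) (dcoev (D X)))"

text \<open>Positivity of an endomorphism of the unit object refers to the identification of
  \<open>Hom(1,1)\<close> with the complex numbers.\<close>

definition weakly_positive ::
  "('o, 'a) lin_moncat \<Rightarrow> ('o \<Rightarrow> ('o, 'a) dual_datum) \<Rightarrow> 'a \<Rightarrow> 'o \<Rightarrow> bool" where
  "weakly_positive C D \<alpha> X \<longleftrightarrow>
     (\<forall>b \<in> hom C X X. cmp C b b = b \<and> b \<noteq> zarr C X X \<longrightarrow>
        (\<exists>r::real. r > 0 \<and> tr C D X (cmp C \<alpha> b) = scal C (complex_of_real r) (idm C (unt C))))"


section \<open>Frobenius algebras\<close>

record ('o, 'a) frob =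
  fobj :: 'o
  fmul :: 'a
  fcomul :: 'a
  funit :: 'a
  fcounit :: 'a

definition frobenius_algebra :: "('o, 'a) lin_moncat \<Rightarrow> ('o, 'a) frob \<Rightarrow> bool" where
  "frobenius_algebra C A \<longleftrightarrow> (let X = fobj A; m = fmul A; \<delta> = fcomul A; e = funit A; \<epsilon> = fcounit A;
       I = idm C X in
     X \<in> obj C \<and>
     m \<in> hom C (tobj C X X) X \<and> e \<in> hom C (unt C) X \<and>
     \<delta> \<in> hom C X (tobj C X X) \<and> \<epsilon> \<in> hom C X (unt C) \<and>
     cmp C m (tarr C m I) = cmp C m (tarr C I m) \<and>
     cmp C m (tarr C e I) = I \<and> cmp C m (tarr C I e) = I \<and>
     cmp C (tarr C \<delta> I) \<delta> = cmp C (tarr C I \<delta>) \<delta> \<and>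
     cmp C (tarr C \<epsilon> I) \<delta> = I \<and> cmp C (tarr C I \<epsilon>) \<delta> = I \<and>
     cmp C (tarr C I m) (tarr C \<delta> I) = cmp C \<delta> m \<and>
     cmp C \<delta> m = cmp C (tarr C m I) (tarr C I \<delta>))"

definition frob_dual :: "('o, 'a) lin_moncat \<Rightarrow> ('o, 'a) frob \<Rightarrow> ('o, 'a) dual_datum" where
  "frob_dual C A = \<lparr> dobj = fobj A, dev = cmp C (fcounit A) (fmul A),
                     dcoev = cmp C (fcomul A) (funit A) \<rparr>"

definition connected_algebra :: "('o, 'a) lin_moncat \<Rightarrow> ('o, 'a) frob \<Rightarrow> bool" where
  "connected_algebra C A \<longleftrightarrow>
     vectorspace.fin_dim class_ring (hom_space C (unt C) (fobj A)) \<and>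
     vectorspace.dim class_ring (hom_space C (unt C) (fobj A)) = 1"

definition algebra_hom ::
  "('o, 'a) lin_moncat \<Rightarrow> ('o, 'a) frob \<Rightarrow> ('o, 'a) frob \<Rightarrow> 'a \<Rightarrow> bool" where
  "algebra_hom C A B f \<longleftrightarrow> f \<in> hom C (fobj A) (fobj B) \<and>
     cmp C (fmul B) (tarr C f f) = cmp C f (fmul A)"

definition algebra_iso ::
  "('o, 'a) lin_moncat \<Rightarrow> ('o, 'a) frob \<Rightarrow> ('o, 'a) frob \<Rightarrow> 'a \<Rightarrow> bool" where
  "algebra_iso C A B f \<longleftrightarrow> algebra_hom C A B f \<and> iso_arr C f"

definition unital_algebra_mono ::
  "('o, 'a) lin_moncat \<Rightarrow> ('o, 'a) frob \<Rightarrow> ('o, 'a) frob \<Rightarrow> 'a \<Rightarrow> bool" where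
  "unital_algebra_mono C A B f \<longleftrightarrow> algebra_hom C A B f \<and> cmp C f (funit A) = funit B \<and> mono_arr C f"

text \<open>Duals of arrows between Frobenius algebras are formed with their Frobenius selfdualities.
  A Frobenius subalgebra is a pair \<open>(A, i)\<close>, since the idempotent depends on the inclusion \<open>i\<close>.\<close>

definition frob_star ::
  "('o, 'a) lin_moncat \<Rightarrow> ('o, 'a) frob \<Rightarrow> ('o, 'a) frob \<Rightarrow> 'a \<Rightarrow> 'a" where
  "frob_star C A B f = dual_arr C (frob_dual C A) (frob_dual C B) f"

definition frobenius_subalgebra ::
  "('o, 'a) lin_moncat \<Rightarrow> ('o, 'a) frob \<Rightarrow> ('o, 'a) frob \<times> 'a \<Rightarrow> bool" where
  "frobenius_subalgebra C X = (\<lambda>(A, i).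
     frobenius_algebra C A \<and> unital_algebra_mono C A X i \<and>
     frob_star C X A (frob_star C A X i) = i \<and>
     cmp C (frob_star C A X i) i = idm C (fobj A))"

definition sub_idem ::
  "('o, 'a) lin_moncat \<Rightarrow> ('o, 'a) frob \<Rightarrow> ('o, 'a) frob \<times> 'a \<Rightarrow> 'a" where
  "sub_idem C X = (\<lambda>(A, i). cmp C i (frob_star C A X i))"

definition sub_equiv ::
  "('o, 'a) lin_moncat \<Rightarrow> ('o, 'a) frob
     \<Rightarrow> ((('o, 'a) frob \<times> 'a) \<times> (('o, 'a) frob \<times> 'a)) set" where
  "sub_equiv C X = {(S, T). frobenius_subalgebra C X S \<and> frobenius_subalgebra C X T \<and>
                            sub_idem C X S = sub_idem C X T}"

definition sub_class ::
  "('o, 'a) lin_moncat \<Rightarrow> ('o, 'a) frob \<Rightarrow> ('o, 'a) frob \<times> 'a \<Rightarrow> (('o, 'a) frob \<times> 'a) set" where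
  "sub_class C X S = sub_equiv C X `` {S}"

definition frob_sub_poset ::
  "('o, 'a) lin_moncat \<Rightarrow> ('o, 'a) frob \<Rightarrow> (('o, 'a) frob \<times> 'a) set gorder" where
  "frob_sub_poset C X =
     \<lparr> carrier = {S. frobenius_subalgebra C X S} // sub_equiv C X,
       eq = (=),
       le = (\<lambda>a b. \<exists>S \<in> a. \<exists>T \<in> b.
              cmp C (sub_idem C X S) (sub_idem C X T) = sub_idem C X S \<and>
              cmp C (sub_idem C X T) (sub_idem C X S) = sub_idem C X S) \<rparr>"


section \<open>Subobjects and ambient selfduality\<close>

text \<open>Subobjects of \<open>X\<close> are represented by monomorphisms into \<open>X\<close>.\<close>

definition sub_le :: "('o, 'a) lin_moncat \<Rightarrow> 'a \<Rightarrow> 'a \<Rightarrow> bool" where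
  "sub_le C i j \<longleftrightarrow> (\<exists>u \<in> hom C (src C i) (src C j). cmp C j u = i)"

definition is_pullback :: "('o, 'a) lin_moncat \<Rightarrow> 'a \<Rightarrow> 'a \<Rightarrow> 'a \<Rightarrow> 'a \<Rightarrow> bool" where
  "is_pullback C i j p q \<longleftrightarrow>
     i \<in> arr C \<and> j \<in> arr C \<and> p \<in> arr C \<and> q \<in> arr C \<and>
     tgt C i = tgt C j \<and> src C p = src C q \<and> tgt C p = src C i \<and> tgt C q = src C j \<and>
     cmp C i p = cmp C j q \<and>
     (\<forall>W. \<forall>g \<in> hom C W (src C i). \<forall>h \<in> hom C W (src C j). cmp C i g = cmp C j h \<longrightarrow>
        (\<exists>!u. u \<in> hom C W (src C p) \<and> cmp C p u = g \<and> cmp C q u = h))"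

definition is_intersection :: "('o, 'a) lin_moncat \<Rightarrow> 'a \<Rightarrow> 'a \<Rightarrow> 'a \<Rightarrow> bool" where
  "is_intersection C i j k \<longleftrightarrow> (\<exists>p q. is_pullback C i j p q \<and> k = cmp C i p)"

definition is_subobject_join :: "('o, 'a) lin_moncat \<Rightarrow> 'a \<Rightarrow> 'a \<Rightarrow> 'a \<Rightarrow> bool" where
  "is_subobject_join C i j s \<longleftrightarrow>
     mono_arr C s \<and> tgt C s = tgt C i \<and> tgt C s = tgt C j \<and> sub_le C i s \<and> sub_le C j s \<and>
     (\<forall>t. mono_arr C t \<and> tgt C t = tgt C s \<and> sub_le C i t \<and> sub_le C j t \<longrightarrow> sub_le C s t)"

definition splits :: "('o, 'a) lin_moncat \<Rightarrow> 'a \<Rightarrow> 'o \<Rightarrow> 'a \<Rightarrow> 'a \<Rightarrow> bool" where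
  "splits C b B i p \<longleftrightarrow> B \<in> obj C \<and> b \<in> hom C (src C b) (src C b) \<and>
     i \<in> hom C B (src C b) \<and> p \<in> hom C (src C b) B \<and>
     cmp C p i = idm C B \<and> cmp C i p = b"

text \<open>Here \<open>d\<close> is a selfduality of the ambient object, that is, \<open>dobj d\<close> is the ambient object itself.
  The dual \<open>d'\<close> of the split subobject \<open>(B, i, p)\<close> is the one obtained from the splitting
  \<open>(dobj d', i', p')\<close> of the dual of its idempotent.\<close>

definition is_ambient_dual ::
  "('o, 'a) lin_moncat \<Rightarrow> ('o, 'a) dual_datum \<Rightarrow> 'o \<Rightarrow> 'a \<Rightarrow> 'a
     \<Rightarrow> 'a \<Rightarrow> 'a \<Rightarrow> ('o, 'a) dual_datum \<Rightarrow> bool" where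
  "is_ambient_dual C d B i p i' p' d' \<longleftrightarrow>
     splits C (cmp C i p) B i p \<and>
     splits C (dual_arr C d d (cmp C i p)) (dobj d') i' p' \<and>
     dev d' = cmp C (dev d) (tarr C i' i) \<and>
     dcoev d' = cmp C (tarr C p p') (dcoev d)"

text \<open>A subobject is ambiently selfdual if for some retraction \<open>p\<close> of its inclusion \<open>i\<close> one may take
  \<open>B' = B\<close>, \<open>i' = i\<close>, \<open>p' = p\<close>; the resulting idempotent \<open>i p\<close> does not depend on the choice of such a
  \<open>p\<close>.\<close>

definition ambiently_selfdual ::
  "('o, 'a) lin_moncat \<Rightarrow> ('o, 'a) dual_datum \<Rightarrow> 'a \<Rightarrow> bool" where
  "ambiently_selfdual C d i \<longleftrightarrow> i \<in> hom C (src C i) (dobj d) \<and>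
     (\<exists>p d'. is_ambient_dual C d (src C i) i p i p d' \<and> dobj d' = src C i)"

definition coherent_pair ::
  "('o, 'a) lin_moncat \<Rightarrow> ('o, 'a) dual_datum \<Rightarrow> 'a \<Rightarrow> 'a \<Rightarrow> bool" where
  "coherent_pair C d i j \<longleftrightarrow>
     ambiently_selfdual C d i \<and> ambiently_selfdual C d j \<and>
     (\<exists>k. is_intersection C i j k \<and> ambiently_selfdual C d k) \<and>
     (\<exists>s. is_subobject_join C i j s \<and> ambiently_selfdual C d s)"

text \<open>A sublattice of a poset is a subset which is a lattice in the induced order; this covers in
  particular subsets closed under existing binary meets and joins of the poset.\<close>

definition frob_sublattice ::
  "('o, 'a) lin_moncat \<Rightarrow> ('o, 'a) frob \<Rightarrow> (('o, 'a) frob \<times> 'a) set set \<Rightarrow> bool" where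
  "frob_sublattice C X L \<longleftrightarrow>
     L \<subseteq> carrier (frob_sub_poset C X) \<and> lattice ((frob_sub_poset C X)\<lparr>carrier := L\<rparr>)"

definition coherent_sublattice ::
  "('o, 'a) lin_moncat \<Rightarrow> ('o, 'a) frob \<Rightarrow> (('o, 'a) frob \<times> 'a) set set \<Rightarrow> bool" where
  "coherent_sublattice C X L \<longleftrightarrow> frob_sublattice C X L \<and>
     (\<exists>z. least (frob_sub_poset C X) z L) \<and>
     (\<forall>a \<in> L. \<forall>b \<in> L. \<forall>(A, i) \<in> a. \<forall>(B, j) \<in> b.
        coherent_pair C (frob_dual C X) i j \<and>
        (\<exists>W k. is_intersection C i j k \<and> fobj W = src C k \<and>
           frobenius_subalgebra C X (W, k) \<and>
           a \<sqinter>\<^bsub>(frob_sub_poset C X)\<lparr>carrier := L\<rparr>\<^esub> b = sub_class C X (W, k)))"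

end

theory Submission
  imports Defs
begin

text \<open>
  The poset of Frobenius subalgebras of \<open>X\<close> has one element for each idempotent \<open>b = i i\<^sup>*\<close> in
  \<open>End(X)\<close>, and the proof shows that only finitely many such idempotents exist.  The reason is
  the rigidity of separable subalgebras of a connected algebra, made uniform so that it can be used
  in a finite-dimensional space.

  Write \<open>u \<star> v\<close> for the product of two arrows into \<open>X\<close> and \<open>\<kappa>\<close> for the copairing of \<open>X\<close>.  The
  idempotents in question are selfadjoint for the Frobenius pairing and their images are subalgebras,
  so \<open>b\<close> is a bimodule map over its image (\<open>expectation\<close>).  Every state of \<open>X\<close> is a
  multiple of the unit, which makes several averages scalar.  First, averaging the algebra
  automorphism \<open>\<phi>\<close> gives a scalar \<open>l\<close> with \<open>l \<phi> = l 1\<close>, and \<open>l \<noteq> 0\<close> by weak positivity; hence \<open>\<phi> = 1\<close>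
  (\<open>automorphism_trivial\<close>), and weak positivity then says that the average \<open>(b \<star> b) \<kappa>\<close>, whose
  counit is the trace of \<open>b\<close>, does not vanish.

  Now let \<open>a\<close> and \<open>b\<close> be two such idempotents.  The map \<open>b\<close> restricted to the image of \<open>a\<close> is multiplicative
  up to an error that is quadratic in the defect \<open>d = a - b a\<close>.  In the classical proof that a
  separable algebra has only inner derivations one averages over the copairing of \<open>a\<close>; carried out
  for \<open>b\<close> in place of an infinitesimal deformation of \<open>a\<close>, the same computation gives
  \<open>R d = l d\<close>, where \<open>l\<close> is the scalar average of \<open>b a\<close> against \<open>a\<close> and \<open>R\<close> is an endomorphism that itself
  depends linearly on \<open>d\<close> (\<open>averaging_identity\<close>).  So the element \<open>l - R\<close> of \<open>End(X)\<close>
  (called \<open>obstruction b a\<close>) kills \<open>d\<close>, while for \<open>a = b\<close> it is the nonzero scalar \<open>l\<close>.  If \<open>a \<noteq> b\<close> then the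
  defect of \<open>a\<close> against \<open>b\<close> or that of \<open>b\<close> against \<open>a\<close> is nonzero, so that one of the two obstructions
  is singular.

  The obstruction is polynomial in \<open>a\<close> and \<open>b\<close>.  Hence the product of the determinants of left
  multiplication by the two obstructions is a kernel of finite rank,
  that is a finite sum \<open>\<Sum> g\<^sub>j(a) h\<^sub>j(b)\<close>, which vanishes exactly off the diagonal.  Such a kernel can
  exist only on a finite set (\<open>finite_if_diagonal_kernel\<close>).
\<close>

section \<open>Kernels of finite rank\<close>

definition finite_rank :: "('p \<Rightarrow> 'p \<Rightarrow> 'c::field) \<Rightarrow> bool" where
  "finite_rank K \<longleftrightarrow> (\<exists>ps. \<forall>x y. K x y = (\<Sum>(g, h)\<leftarrow>ps. g x * h y))"

lemma finite_rank_rank_one: "finite_rank (\<lambda>x y. g x * h y)"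
  unfolding finite_rank_def by (rule exI[of _ "[(g, h)]"]) simp

lemma finite_rank_first: "finite_rank (\<lambda>x y. g x)"
  using finite_rank_rank_one[of g "\<lambda>_. 1"] by simp

lemma finite_rank_second: "finite_rank (\<lambda>x y. h y)"
  using finite_rank_rank_one[of "\<lambda>_. 1" h] by simp

lemma finite_rank_add:
  assumes "finite_rank K" "finite_rank K'"
  shows "finite_rank (\<lambda>x y. K x y + K' x y)"
proof -
  from assms obtain ps qs where
    "\<forall>x y. K x y = (\<Sum>(g, h)\<leftarrow>ps. g x * h y)" "\<forall>x y. K' x y = (\<Sum>(g, h)\<leftarrow>qs. g x * h y)"
    unfolding finite_rank_def by blast
  then show ?thesis
    unfolding finite_rank_def by (intro exI[of _ "ps @ qs"]) simp
qed

lemma finite_rank_rank_one_mult: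
  assumes "finite_rank K"
  shows "finite_rank (\<lambda>x y. g x * h y * K x y)"
proof -
  from assms obtain ps where ps: "\<forall>x y. K x y = (\<Sum>(g, h)\<leftarrow>ps. g x * h y)"
    unfolding finite_rank_def by blast
  have "g x * h y * K x y
      = (\<Sum>(g', h')\<leftarrow>map (\<lambda>(g', h'). (\<lambda>x. g x * g' x, \<lambda>y. h y * h' y)) ps. g' x * h' y)" for x y
    unfolding ps[rule_format] by (induction ps) (auto simp: algebra_simps)
  then show ?thesis unfolding finite_rank_def by blast
qed

lemma finite_rank_mult:
  assumes "finite_rank K" "finite_rank K'"
  shows "finite_rank (\<lambda>x y. K x y * K' x y)"
proof -
  from assms(1) obtain ps where ps: "\<forall>x y. K x y = (\<Sum>(g, h)\<leftarrow>ps. g x * h y)"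
    unfolding finite_rank_def by blast
  have "finite_rank (\<lambda>x y. (\<Sum>(g, h)\<leftarrow>ps. g x * h y) * K' x y)"
  proof (induction ps)
    case Nil
    show ?case using finite_rank_first[of "\<lambda>_. 0"] by simp
  next
    case (Cons p ps)
    obtain g h where "p = (g, h)" by force
    then show ?case
      using finite_rank_add[OF finite_rank_rank_one_mult[OF assms(2)] Cons.IH]
      by (simp add: distrib_right)
  qed
  then show ?thesis by (simp add: ps)
qed

lemma finite_rank_swap:
  assumes "finite_rank K"
  shows "finite_rank (\<lambda>x y. K y x)"
proof -
  from assms obtain ps where ps: "\<forall>x y. K x y = (\<Sum>(g, h)\<leftarrow>ps. g x * h y)"
    unfolding finite_rank_def by blast
  have "K y x = (\<Sum>(g, h)\<leftarrow>map prod.swap ps. g x * h y)" for x y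
    unfolding ps[rule_format] by (induction ps) (auto simp: mult.commute)
  then show ?thesis unfolding finite_rank_def by blast
qed

lemma finite_rank_sum:
  assumes "\<And>i. i \<in> I \<Longrightarrow> finite_rank (K i)"
  shows "finite_rank (\<lambda>x y. \<Sum>i\<in>I. K i x y)"
  using assms
  by (induction I rule: infinite_finite_induct)
    (auto intro: finite_rank_add finite_rank_first[of "\<lambda>_. 0"])

lemma finite_rank_prod:
  assumes "\<And>i. i \<in> I \<Longrightarrow> finite_rank (K i)"
  shows "finite_rank (\<lambda>x y. \<Prod>i\<in>I. K i x y)"
  using assms
  by (induction I rule: infinite_finite_induct)
    (auto intro: finite_rank_mult finite_rank_first[of "\<lambda>_. 1"])

text \<open>By the Leibniz formula.\<close>
lemma finite_rank_det:
  assumes "\<And>i j. i < n \<Longrightarrow> j < n \<Longrightarrow> finite_rank (\<lambda>x y. M x y $$ (i, j))"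
    and "\<And>x y. M x y \<in> carrier_mat n n"
  shows "finite_rank (\<lambda>x y. det (M x y))"
proof -
  have "finite_rank (\<lambda>x y. \<Sum>p | p permutes {0..<n}. signof p * (\<Prod>i = 0..<n. M x y $$ (i, p i)))"
    by (intro finite_rank_sum finite_rank_mult finite_rank_prod finite_rank_first assms(1))
      (auto dest: permutes_in_image)
  then show ?thesis by (simp add: det_def'[OF assms(2)])
qed

text \<open>Restricted to \<open>P\<close>, the kernel is an invertible diagonal matrix, so its rank bounds the size
  of \<open>P\<close>.  The induction on the rank is one step of Gaussian elimination: a point \<open>z\<close> with \<open>g\<^sub>0(z) \<noteq> 0\<close>
  is dropped, and a multiple of its row, which vanishes on the other points, is subtracted from every
  row in order to remove the term of \<open>g\<^sub>0\<close>.\<close>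
lemma finite_if_diagonal_kernel:
  assumes "finite_rank K"
    and "\<And>x. x \<in> P \<Longrightarrow> K x x \<noteq> 0"
    and "\<And>x y. x \<in> P \<Longrightarrow> y \<in> P \<Longrightarrow> x \<noteq> y \<Longrightarrow> K x y = 0"
  shows "finite P"
proof -
  have "finite P"
    if "\<And>x. x \<in> P \<Longrightarrow> (\<Sum>(g, h)\<leftarrow>ps. g x * h x) \<noteq> 0"
      and "\<And>x y. x \<in> P \<Longrightarrow> y \<in> P \<Longrightarrow> x \<noteq> y \<Longrightarrow> (\<Sum>(g, h)\<leftarrow>ps. g x * h y) = 0"
    for ps :: "(('a \<Rightarrow> 'b) \<times> ('a \<Rightarrow> 'b)) list" and P
    using that
  proof (induction "length ps" arbitrary: ps P)
    case 0
    then have "P = {}" by auto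
    then show ?case by simp
  next
    case (Suc n)
    then obtain g0 h0 qs where ps: "ps = (g0, h0) # qs" and qs: "n = length qs"
      by (metis length_Suc_conv surj_pair)
    show ?case
    proof (cases "\<exists>z\<in>P. g0 z \<noteq> 0")
      case False
      then show ?thesis
        using Suc.hyps(1)[OF qs, of P] Suc.prems unfolding ps by auto
    next
      case True
      then obtain z where z: "z \<in> P" "g0 z \<noteq> 0" by blast
      define rs where "rs = map (\<lambda>(g, h). (\<lambda>x. g x - g0 x / g0 z * g z, h)) qs"
      have length_rs: "length rs = length qs" by (simp add: rs_def)
      have rs: "(\<Sum>(g, h)\<leftarrow>rs. g x * h y)
          = (\<Sum>(g, h)\<leftarrow>ps. g x * h y) - g0 x / g0 z * (\<Sum>(g, h)\<leftarrow>ps. g z * h y)" for x y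
      proof -
        have "(\<Sum>(g, h)\<leftarrow>rs. g x * h y)
          = (\<Sum>(g, h)\<leftarrow>qs. g x * h y) - g0 x / g0 z * (\<Sum>(g, h)\<leftarrow>qs. g z * h y)"
          unfolding rs_def by (induction qs) (auto simp: algebra_simps)
        then show ?thesis using z by (simp add: ps algebra_simps)
      qed
      have "finite (P - {z})"
        by (rule Suc.hyps(1)[of rs]) (use Suc.prems z in \<open>auto simp: rs qs length_rs\<close>)
      then show ?thesis by simp
    qed
  qed
  note finite_P = this
  from assms(1) obtain ps where "\<forall>x y. K x y = (\<Sum>(g, h)\<leftarrow>ps. g x * h y)"
    unfolding finite_rank_def by blast
  with assms(2,3) show ?thesis by (intro finite_P[of P ps]) auto
qed

section \<open>Families of vectors of finite rank\<close>

definition linear_form :: "('c::field, 'v) module \<Rightarrow> ('v \<Rightarrow> 'c) \<Rightarrow> bool" where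
  "linear_form V f \<longleftrightarrow>
     (\<forall>x \<in> carrier V. \<forall>y \<in> carrier V. f (x \<oplus>\<^bsub>V\<^esub> y) = f x + f y) \<and>
     (\<forall>c. \<forall>x \<in> carrier V. f (c \<odot>\<^bsub>V\<^esub> x) = c * f x)"

abbreviation linear_maps ::
  "('c::field, 'v) module \<Rightarrow> ('c, 'w) module \<Rightarrow> ('v \<Rightarrow> 'w) set" where
  "linear_maps V W \<equiv> LinearCombinations.module_hom class_ring V W"

lemma linear_form_compose:
  assumes "T \<in> linear_maps V W" "linear_form W f"
  shows "linear_form V (\<lambda>x. f (T x))"
  using assms unfolding LinearCombinations.module_hom_def linear_form_def by (auto simp: Pi_iff)

lemma linear_form_zero:
  assumes "vectorspace class_ring V" "linear_form V f"
  shows "f \<zero>\<^bsub>V\<^esub> = 0"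
proof -
  interpret vectorspace class_ring V by fact
  have "f \<zero>\<^bsub>V\<^esub> + f \<zero>\<^bsub>V\<^esub> = f \<zero>\<^bsub>V\<^esub>"
    using assms(2) M.zero_closed M.l_zero unfolding linear_form_def by metis
  then show ?thesis by (metis add_cancel_left_left)
qed

lemma linear_maps_compose:
  assumes "S \<in> linear_maps U V" "T \<in> linear_maps V W"
  shows "(\<lambda>x. T (S x)) \<in> linear_maps U W"
  using assms unfolding LinearCombinations.module_hom_def by (auto simp: Pi_iff)

text \<open>Stating the expansion in the basis \<open>u\<close> for all linear forms at once avoids sums in \<open>V\<close>.\<close>
lemma coordinates_exist:
  fixes V :: "('c::field, 'v) module"
  assumes "vectorspace class_ring V" "vectorspace.fin_dim class_ring V"
  obtains n :: nat and u \<kappa> where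
    "\<And>i. i < n \<Longrightarrow> u i \<in> carrier V"
    "\<And>i. i < n \<Longrightarrow> linear_form V (\<kappa> i)"
    "\<And>i j. i < n \<Longrightarrow> j < n \<Longrightarrow> \<kappa> i (u j) = (if i = j then 1 else 0)"
    "\<And>f x. linear_form V f \<Longrightarrow> x \<in> carrier V \<Longrightarrow> f x = (\<Sum>j<n. \<kappa> j x * f (u j))"
    "\<And>x. x \<in> carrier V \<Longrightarrow> (\<And>i. i < n \<Longrightarrow> \<kappa> i x = 0) \<Longrightarrow> x = \<zero>\<^bsub>V\<^esub>"
proof -
  interpret vectorspace class_ring V by fact
  obtain B where B: "finite B" "basis B"
    using finite_basis_exists[OF assms(2)] by blast
  then have BV: "B \<subseteq> carrier V" and li: "lin_indpt B" unfolding basis_def by auto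
  have crit: "\<exists>!a. a \<in> B \<rightarrow>\<^sub>E UNIV \<and> lincomb a B = v" if "v \<in> carrier V" for v
    using basis_criterion[OF B(1) BV] B(2) that by simp
  have one_smult: "(1::'c) \<odot>\<^bsub>V\<^esub> v = v" if "v \<in> carrier V" for v
    using smult_one[OF that] by (simp del: smult_one)
  define a where "a v = (THE a. a \<in> B \<rightarrow>\<^sub>E UNIV \<and> lincomb a B = v)" for v
  have a: "a v \<in> B \<rightarrow>\<^sub>E UNIV" "lincomb (a v) B = v" if "v \<in> carrier V" for v
    using theI'[OF crit[OF that]] unfolding a_def by auto
  have lc: "lincomb (restrict c B) B = lincomb c B" for c
    by (rule lincomb_cong) (use BV in auto)
  have uniq: "c b = a v b" if "lincomb c B = v" "v \<in> carrier V" "b \<in> B" for c v b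
  proof -
    have "restrict c B = a v"
      using crit[OF that(2)] a[OF that(2)] lc[of c] that(1) by auto
    then show ?thesis using that(3) by (metis restrict_apply')
  qed
  have form: "linear_form V (\<lambda>v. a v b)" if b: "b \<in> B" for b
    unfolding linear_form_def
  proof (intro conjI ballI allI)
    fix x y assume xy: "x \<in> carrier V" "y \<in> carrier V"
    have "lincomb (\<lambda>v. a x v + a y v) B = lincomb (a x) B \<oplus>\<^bsub>V\<^esub> lincomb (a y) B"
      using lincomb_sum[OF B(1) BV, of "a x" "a y"] by simp
    then show "a (x \<oplus>\<^bsub>V\<^esub> y) b = a x b + a y b"
      using uniq[of "\<lambda>v. a x v + a y v" "x \<oplus>\<^bsub>V\<^esub> y"] a xy b by simp
  next
    fix c x assume x: "x \<in> carrier V"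
    have "lincomb (\<lambda>v. c * a x v) B = c \<odot>\<^bsub>V\<^esub> x"
      using lincomb_smult[OF BV, of "a x" c] a[OF x] by simp
    then show "a (c \<odot>\<^bsub>V\<^esub> x) b = c * a x b"
      using uniq[of "\<lambda>v. c * a x v" "c \<odot>\<^bsub>V\<^esub> x"] x b by simp
  qed
  have expand: "f (lincomb c B') = (\<Sum>b\<in>B'. c b * f b)"
    if f: "linear_form V f" and "B' \<subseteq> B" for f c B'
  proof -
    have "finite B'" using that B(1) finite_subset by blast
    then show ?thesis using \<open>B' \<subseteq> B\<close>
    proof (induction B')
      case empty
      show ?case using linear_form_zero[OF assms(1) f] by (simp add: lincomb_def)
    next
      case (insert b B')
      have "lincomb c (insert b B') = (c b \<odot>\<^bsub>V\<^esub> b) \<oplus>\<^bsub>V\<^esub> lincomb c B'"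
        using lincomb_insert[OF insert.hyps(1), of c b] insert BV by auto
      moreover have "lincomb c B' \<in> carrier V" "b \<in> carrier V"
        using insert.prems BV by auto
      ultimately show ?case using insert f unfolding linear_form_def by simp
    qed
  qed
  obtain u n where un: "bij_betw u {..<n::nat} B"
    using ex_bij_betw_nat_finite[OF B(1)] atLeast0LessThan by metis
  then have uB: "u i \<in> B" if "i < n" for i using that by (auto simp: bij_betw_def)
  show ?thesis
  proof (rule that[of n u "\<lambda>i v. a v (u i)"])
    show "u i \<in> carrier V" if "i < n" for i using uB[OF that] BV by auto
    show "linear_form V (\<lambda>v. a v (u i))" if "i < n" for i using form uB[OF that] by blast
    show "a (u j) (u i) = (if i = j then 1 else 0)" if ij: "i < n" "j < n" for i j
    proof -
      have j: "u j \<in> carrier V" using uB ij BV by auto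
      have "lincomb (\<lambda>v. if v = u j then 1 else 0) {u j} = u j"
        using j one_smult[OF j] by (simp add: lincomb_def del: smult_one)
      moreover have "lincomb (\<lambda>v. if v = u j then 1 else 0) B
          = ((if u j = u j then 1 else 0) \<odot>\<^bsub>V\<^esub> u j)
            \<oplus>\<^bsub>V\<^esub> lincomb (\<lambda>v. if v = u j then 1 else 0) (B - {u j})"
        by (rule lincomb_del2[OF B(1) BV]) (use uB ij in auto)
      moreover have "lincomb (\<lambda>v. if v = u j then 1 else 0) (B - {u j})
          = lincomb (\<lambda>v. 0) (B - {u j})"
        by (rule lincomb_cong) (use BV in auto)
      moreover have "lincomb (\<lambda>v. 0) (B - {u j}) = \<zero>\<^bsub>V\<^esub>"
        using BV by (intro lincomb_zero) auto
      ultimately have "lincomb (\<lambda>v. if v = u j then 1 else 0) B = u j"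
        using j one_smult[OF j] by (simp del: smult_one)
      from uniq[OF this j uB[OF ij(1)]] have "a (u j) (u i) = (if u i = u j then 1 else 0)"
        by simp
      moreover have "u i = u j \<longleftrightarrow> i = j"
        using un ij by (auto simp: bij_betw_def inj_on_def)
      ultimately show ?thesis by simp
    qed
    show "f x = (\<Sum>j<n. a x (u j) * f (u j))" if "linear_form V f" "x \<in> carrier V" for f x
      using expand[OF that(1) order.refl, of "a x"] a[OF that(2)]
        sum.reindex_bij_betw[OF un, of "\<lambda>b. a x b * f b"] by simp
    show "x = \<zero>\<^bsub>V\<^esub>" if x: "x \<in> carrier V" "\<And>i. i < n \<Longrightarrow> a x (u i) = 0" for x
    proof -
      have "a x b = 0" if b: "b \<in> B" for b
      proof -
        obtain i where "i < n" "b = u i" using un b unfolding bij_betw_def by auto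
        then show ?thesis using x(2) by simp
      qed
      then have "lincomb (a x) B = lincomb (\<lambda>_. 0) B"
        by (intro lincomb_cong) (use BV in auto)
      also have "\<dots> = \<zero>\<^bsub>V\<^esub>" using BV by (intro lincomb_zero) auto
      finally show ?thesis using a x(1) by simp
    qed
  qed
qed

text \<open>Coordinates are replaced by arbitrary linear forms, so that no basis has to be fixed.\<close>
definition finite_rank_family :: "('c::field, 'v) module \<Rightarrow> ('p \<Rightarrow> 'p \<Rightarrow> 'v) \<Rightarrow> bool" where
  "finite_rank_family V F \<longleftrightarrow> (\<forall>x y. F x y \<in> carrier V) \<and>
     (\<forall>f. linear_form V f \<longrightarrow> finite_rank (\<lambda>x y. f (F x y)))"

definition bilinear_op :: "('c::field, 'v) module \<Rightarrow> ('v \<Rightarrow> 'v \<Rightarrow> 'v) \<Rightarrow> bool" where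
  "bilinear_op V B \<longleftrightarrow> (\<forall>x \<in> carrier V.
     B x \<in> linear_maps V V \<and> (\<lambda>y. B y x) \<in> linear_maps V V)"

lemma finite_rank_familyD:
  assumes "finite_rank_family V F"
  shows "F x y \<in> carrier V" "linear_form V f \<Longrightarrow> finite_rank (\<lambda>x y. f (F x y))"
  using assms unfolding finite_rank_family_def by auto

lemma linear_maps_closed: "T \<in> linear_maps V W \<Longrightarrow> x \<in> carrier V \<Longrightarrow> T x \<in> carrier W"
  unfolding LinearCombinations.module_hom_def by auto

lemma finite_rank_family_first:
  "(\<And>x. g x \<in> carrier V) \<Longrightarrow> finite_rank_family V (\<lambda>x y. g x)"
  unfolding finite_rank_family_def by (auto intro: finite_rank_first)

lemma finite_rank_family_second:
  "(\<And>x. g x \<in> carrier V) \<Longrightarrow> finite_rank_family V (\<lambda>x y. g y)"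
  unfolding finite_rank_family_def by (auto intro: finite_rank_second)

lemma finite_rank_family_add:
  assumes "vectorspace class_ring V" "finite_rank_family V F" "finite_rank_family V G"
  shows "finite_rank_family V (\<lambda>x y. F x y \<oplus>\<^bsub>V\<^esub> G x y)"
proof -
  interpret vectorspace class_ring V by fact
  have FG: "F x y \<in> carrier V" "G x y \<in> carrier V" for x y
    using assms(2,3) unfolding finite_rank_family_def by auto
  have "finite_rank (\<lambda>x y. f (F x y \<oplus>\<^bsub>V\<^esub> G x y))" if f: "linear_form V f" for f
  proof -
    have "(\<lambda>x y. f (F x y \<oplus>\<^bsub>V\<^esub> G x y)) = (\<lambda>x y. f (F x y) + f (G x y))"
      using f FG unfolding linear_form_def by auto
    then show ?thesis
      using finite_rank_add[OF finite_rank_familyD(2)[OF assms(2) f] finite_rank_familyD(2)[OF assms(3) f]]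
      by simp
  qed
  then show ?thesis using FG unfolding finite_rank_family_def by auto
qed

lemma finite_rank_family_hom:
  assumes "T \<in> linear_maps V V" "finite_rank_family V F"
  shows "finite_rank_family V (\<lambda>x y. T (F x y))"
  unfolding finite_rank_family_def
  using linear_maps_closed[OF assms(1)] finite_rank_familyD[OF assms(2)]
    finite_rank_familyD(2)[OF assms(2) linear_form_compose[OF assms(1)]] by auto

text \<open>Expanding the first argument of \<open>B\<close> in a basis turns \<open>B (F x y) x y\<close> into a finite sum of products
  of a coordinate of \<open>F x y\<close> and a family with constant first argument.  The operation \<open>B\<close> may depend
  on the points, which lets the lemma be iterated for operations of several arguments.\<close>
lemma finite_rank_family_bilinear:
  assumes V: "vectorspace class_ring V" "vectorspace.fin_dim class_ring V"
    and F: "finite_rank_family V F"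
    and B: "\<And>v. v \<in> carrier V \<Longrightarrow> finite_rank_family V (\<lambda>x y. B v x y)"
    and lin: "\<And>x y. (\<lambda>v. B v x y) \<in> linear_maps V V"
  shows "finite_rank_family V (\<lambda>x y. B (F x y) x y)"
proof -
  obtain n u \<kappa> where u: "\<And>i. i < n \<Longrightarrow> u i \<in> carrier V"
    and \<kappa>: "\<And>i. i < (n::nat) \<Longrightarrow> linear_form V (\<kappa> i)"
    and expand: "\<And>f x. linear_form V f \<Longrightarrow> x \<in> carrier V \<Longrightarrow> f x = (\<Sum>j<n. \<kappa> j x * f (u j))"
    by (rule coordinates_exist[OF V]) blast
  have FV: "F x y \<in> carrier V" for x y using F unfolding finite_rank_family_def by auto
  have "finite_rank (\<lambda>x y. f (B (F x y) x y))" if f: "linear_form V f" for f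
  proof -
    have "f (B (F x y) x y) = (\<Sum>j<n. \<kappa> j (F x y) * f (B (u j) x y))" for x y
      by (rule expand[OF linear_form_compose[OF lin f] FV])
    moreover have "finite_rank (\<lambda>x y. \<Sum>j<n. \<kappa> j (F x y) * f (B (u j) x y))"
      using F B[OF u] \<kappa> f unfolding finite_rank_family_def
      by (intro finite_rank_sum finite_rank_mult) auto
    ultimately show ?thesis by simp
  qed
  moreover have "B (F x y) x y \<in> carrier V" for x y
    by (rule linear_maps_closed[OF lin FV])
  ultimately show ?thesis unfolding finite_rank_family_def by auto
qed

lemma finite_rank_family_op:
  assumes V: "vectorspace class_ring V" "vectorspace.fin_dim class_ring V"
    and B: "bilinear_op V B"
    and F: "finite_rank_family V F" and G: "finite_rank_family V G"
  shows "finite_rank_family V (\<lambda>x y. B (F x y) (G x y))"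
proof (rule finite_rank_family_bilinear[OF V F, where B = "\<lambda>v x y. B v (G x y)"])
  show "finite_rank_family V (\<lambda>x y. B v (G x y))" if "v \<in> carrier V" for v
    by (rule finite_rank_family_hom[OF _ G]) (use B that in \<open>auto simp: bilinear_op_def\<close>)
  show "(\<lambda>v. B v (G x y)) \<in> linear_maps V V" for x y
    using B finite_rank_familyD(1)[OF G] by (auto simp: bilinear_op_def)
qed

text \<open>Elements of \<open>V\<close> act on \<open>V\<close> as matrices, and the determinant detects which of them are singular:
  \<open>det (F x y) * det (F y x)\<close> is a kernel of finite rank that vanishes exactly off the diagonal of \<open>P\<close>.\<close>
theorem finite_if_singular_family:
  assumes V: "vectorspace class_ring V" "vectorspace.fin_dim class_ring V"
    and bil: "bilinear_op V act"
    and F: "finite_rank_family V F"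
    and diag: "\<And>x v. x \<in> P \<Longrightarrow> v \<in> carrier V \<Longrightarrow> act (F x x) v = c x \<odot>\<^bsub>V\<^esub> v"
    and c: "\<And>x. x \<in> P \<Longrightarrow> c x \<noteq> 0"
    and sing: "\<And>x y. x \<in> P \<Longrightarrow> y \<in> P \<Longrightarrow> x \<noteq> y \<Longrightarrow>
      \<exists>v \<in> carrier V. v \<noteq> \<zero>\<^bsub>V\<^esub> \<and> (act (F x y) v = \<zero>\<^bsub>V\<^esub> \<or> act (F y x) v = \<zero>\<^bsub>V\<^esub>)"
  shows "finite P"
proof -
  interpret vectorspace class_ring V by fact
  obtain n u \<kappa> where u: "\<And>i. i < n \<Longrightarrow> u i \<in> carrier V"
    and \<kappa>: "\<And>i. i < (n::nat) \<Longrightarrow> linear_form V (\<kappa> i)"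
    and dual: "\<And>i j. i < n \<Longrightarrow> j < n \<Longrightarrow> \<kappa> i (u j) = (if i = j then 1 else 0)"
    and expand: "\<And>f x. linear_form V f \<Longrightarrow> x \<in> carrier V \<Longrightarrow> f x = (\<Sum>j<n. \<kappa> j x * f (u j))"
    and zero: "\<And>x. x \<in> carrier V \<Longrightarrow> (\<And>i. i < n \<Longrightarrow> \<kappa> i x = 0) \<Longrightarrow> x = \<zero>\<^bsub>V\<^esub>"
    by (rule coordinates_exist[OF V]) blast
  have FV: "F x y \<in> carrier V" for x y using F unfolding finite_rank_family_def by auto
  define M where "M x y = mat n n (\<lambda>(i, j). \<kappa> i (act (F x y) (u j)))" for x y
  have M: "M x y \<in> carrier_mat n n" for x y by (simp add: M_def)
  have left: "(\<lambda>w. act w v) \<in> linear_maps V V"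
    and right: "act v \<in> linear_maps V V" if "v \<in> carrier V" for v
    using bil that unfolding bilinear_op_def by auto
  have entry: "finite_rank (\<lambda>x y. M x y $$ (i, j))" "finite_rank (\<lambda>x y. M y x $$ (i, j))"
    if "i < n" "j < n" for i j
  proof -
    have lf: "linear_form V (\<lambda>w. \<kappa> i (act w (u j)))"
      using linear_form_compose[OF left[OF u[OF that(2)]] \<kappa>[OF that(1)]] .
    then show 1: "finite_rank (\<lambda>x y. M x y $$ (i, j))"
      using finite_rank_familyD(2)[OF F lf] that by (simp add: M_def)
    then show "finite_rank (\<lambda>x y. M y x $$ (i, j))" by (rule finite_rank_swap)
  qed
  have det_zero: "det (M x y) = 0"
    if v: "v \<in> carrier V" "v \<noteq> \<zero>\<^bsub>V\<^esub>" and mv: "act (F x y) v = \<zero>\<^bsub>V\<^esub>" for x y v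
  proof -
    define w where "w = vec n (\<lambda>j. \<kappa> j v)"
    have "w \<noteq> 0\<^sub>v n"
    proof
      assume "w = 0\<^sub>v n"
      then have "\<kappa> i v = 0" if "i < n" for i
        using that unfolding w_def by (metis index_vec index_zero_vec(1))
      then show False using zero[OF v(1)] v(2) by blast
    qed
    moreover have "M x y *\<^sub>v w = 0\<^sub>v n"
    proof (rule eq_vecI)
      fix i assume "i < dim_vec (0\<^sub>v n :: 'a vec)"
      then have i: "i < n" by simp
      have lf: "linear_form V (\<lambda>w. \<kappa> i (act (F x y) w))"
        by (rule linear_form_compose[OF right[OF FV] \<kappa>[OF i]])
      have "(\<Sum>j<n. \<kappa> j v * \<kappa> i (act (F x y) (u j))) = 0"
        using expand[OF lf v(1)] mv linear_form_zero[OF V(1) \<kappa>[OF i]] by simp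
      then show "(M x y *\<^sub>v w) $ i = 0\<^sub>v n $ i"
        using i by (simp add: M_def w_def scalar_prod_def atLeast0LessThan mult.commute)
    qed (simp add: M_def)
    moreover have "w \<in> carrier_vec n" by (simp add: w_def)
    ultimately show ?thesis
      using det_0_iff_vec_prod_zero[OF M, of x y] by blast
  qed
  show ?thesis
  proof (rule finite_if_diagonal_kernel)
    show "finite_rank (\<lambda>x y. det (M x y) * det (M y x))"
      by (intro finite_rank_mult finite_rank_det[OF _ M] entry)
    show "det (M x x) * det (M x x) \<noteq> 0" if x: "x \<in> P" for x
    proof -
      have "M x x = c x \<cdot>\<^sub>m 1\<^sub>m n"
        using \<kappa> u unfolding M_def
        by (intro eq_matI) (auto simp: diag[OF x u] linear_form_def dual)
      then show ?thesis using c[OF x] by simp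
    qed
    show "det (M x y) * det (M y x) = 0" if "x \<in> P" "y \<in> P" "x \<noteq> y" for x y
      using sing[OF that] det_zero by auto
  qed
qed

section \<open>Linear and tensor calculus of arrows\<close>

lemma hom_space_simps [simp]:
  "carrier (hom_space C X Y) = hom C X Y"
  "zero (hom_space C X Y) = zarr C X Y"
  "add (hom_space C X Y) = padd C"
  "smult (hom_space C X Y) = scal C"
  by (simp_all add: hom_space_def)

context linear_category
begin

lemma hom_obj: "f \<in> hom C X Y \<Longrightarrow> X \<in> obj C" "f \<in> hom C X Y \<Longrightarrow> Y \<in> obj C"
  using src_obj tgt_obj by (auto simp: hom_def)

lemma cmp_left_maps:
  assumes "f \<in> hom C X Y" "Z \<in> obj C"
  shows "(\<lambda>g. g \<cdot> f) \<in> linear_maps (hom_space C Y Z) (hom_space C X Z)"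
proof -
  interpret linear_map class_ring "hom_space C Y Z" "hom_space C X Z" "\<lambda>g. g \<cdot> f"
    by (rule cmp_linear_left[OF assms])
  show ?thesis by (rule f_hom)
qed

lemma cmp_right_maps:
  assumes "g \<in> hom C Y Z" "X \<in> obj C"
  shows "(\<lambda>f. g \<cdot> f) \<in> linear_maps (hom_space C X Y) (hom_space C X Z)"
proof -
  interpret linear_map class_ring "hom_space C X Y" "hom_space C X Z" "\<lambda>f. g \<cdot> f"
    by (rule cmp_linear_right[OF assms])
  show ?thesis by (rule f_hom)
qed

lemma padd_hom: "f \<in> hom C X Y \<Longrightarrow> g \<in> hom C X Y \<Longrightarrow> padd C f g \<in> hom C X Y"
  and scal_hom: "f \<in> hom C X Y \<Longrightarrow> scal C c f \<in> hom C X Y"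
  and zarr_hom: "X \<in> obj C \<Longrightarrow> Y \<in> obj C \<Longrightarrow> zarr C X Y \<in> hom C X Y"
proof -
  have V: "vectorspace class_ring (hom_space C X Y)" if "X \<in> obj C" "Y \<in> obj C"
    by (rule hom_vectorspace[OF that])
  show "padd C f g \<in> hom C X Y" if "f \<in> hom C X Y" "g \<in> hom C X Y"
  proof -
    interpret vectorspace class_ring "hom_space C X Y" by (rule V; rule hom_obj[OF that(1)])
    show ?thesis using M.a_closed[of f g] that by simp
  qed
  show "scal C c f \<in> hom C X Y" if "f \<in> hom C X Y"
  proof -
    interpret vectorspace class_ring "hom_space C X Y" by (rule V; rule hom_obj[OF that(1)])
    show ?thesis using smult_closed[of c f] that by simp
  qed
  show "zarr C X Y \<in> hom C X Y" if "X \<in> obj C" "Y \<in> obj C"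
  proof -
    interpret vectorspace class_ring "hom_space C X Y" by (rule V[OF that])
    show ?thesis using M.zero_closed by simp
  qed
qed

lemma scal_one: "f \<in> hom C X Y \<Longrightarrow> scal C 1 f = f"
  and scal_scal: "f \<in> hom C X Y \<Longrightarrow> scal C c (scal C d f) = scal C (c * d) f"
  and scal_zero: "f \<in> hom C X Y \<Longrightarrow> scal C 0 f = zarr C X Y"
  and padd_zarr: "f \<in> hom C X Y \<Longrightarrow> padd C f (zarr C X Y) = f"
  and padd_minus: "f \<in> hom C X Y \<Longrightarrow> padd C f (scal C (-1) f) = zarr C X Y"
  and padd_cancel: "f \<in> hom C X Y \<Longrightarrow> g \<in> hom C X Y \<Longrightarrow> padd C f (padd C g (scal C (-1) f)) = g"
  and padd_cancel': "f \<in> hom C X Y \<Longrightarrow> g \<in> hom C X Y \<Longrightarrow> padd C (padd C f g) (scal C (-1) f) = g"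
  and scal_padd: "f \<in> hom C X Y \<Longrightarrow> g \<in> hom C X Y
    \<Longrightarrow> scal C c (padd C f g) = padd C (scal C c f) (scal C c g)"
proof -
  have V: "vectorspace class_ring (hom_space C X Y)" if "f \<in> hom C X Y" for f
    by (intro hom_vectorspace hom_obj[OF that])
  have one: "scal C 1 f = f" if "f \<in> hom C X Y" for f
  proof -
    interpret vectorspace class_ring "hom_space C X Y" by (rule V[OF that])
    show ?thesis using smult_one[of f] that by (simp del: smult_one)
  qed
  have minus: "padd C f (scal C (-1) f) = zarr C X Y" if "f \<in> hom C X Y" for f
  proof -
    interpret vectorspace class_ring "hom_space C X Y" by (rule V[OF that])
    have "padd C (scal C 1 f) (scal C (-1) f) = scal C (1 + -1) f"
      using smult_l_distr[of 1 "-1" f] that by simp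
    then show ?thesis using smult_l_null[of f] that one by simp
  qed
  show "scal C 1 f = f" if "f \<in> hom C X Y" by (rule one[OF that])
  show "padd C f (scal C (-1) f) = zarr C X Y" if "f \<in> hom C X Y" by (rule minus[OF that])
  show "scal C c (scal C d f) = scal C (c * d) f" if "f \<in> hom C X Y"
  proof -
    interpret vectorspace class_ring "hom_space C X Y" by (rule V[OF that])
    show ?thesis using smult_assoc1[of c d f] that by simp
  qed
  show "scal C 0 f = zarr C X Y" if "f \<in> hom C X Y"
  proof -
    interpret vectorspace class_ring "hom_space C X Y" by (rule V[OF that])
    show ?thesis using smult_l_null[of f] that by simp
  qed
  show "padd C f (zarr C X Y) = f" if "f \<in> hom C X Y"
  proof -
    interpret vectorspace class_ring "hom_space C X Y" by (rule V[OF that])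
    show ?thesis using M.r_zero[of f] that by simp
  qed
  show "padd C f (padd C g (scal C (-1) f)) = g"
    and "padd C (padd C f g) (scal C (-1) f) = g" if fg: "f \<in> hom C X Y" "g \<in> hom C X Y"
  proof -
    interpret vectorspace class_ring "hom_space C X Y" by (rule V[OF fg(1)])
    have n: "scal C (-1) f \<in> hom C X Y" using smult_closed[of "-1" f] fg by simp
    have "padd C f (padd C g (scal C (-1) f)) = padd C g (padd C f (scal C (-1) f))"
      using M.a_lcomm[of f g "scal C (-1) f"] fg n by simp
    then show "padd C f (padd C g (scal C (-1) f)) = g"
      using M.r_zero[of g] fg minus by simp
    have "padd C (padd C f g) (scal C (-1) f) = padd C f (padd C g (scal C (-1) f))"
      using M.a_assoc[of f g "scal C (-1) f"] fg n by simp
    then show "padd C (padd C f g) (scal C (-1) f) = g"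
      using \<open>padd C f (padd C g (scal C (-1) f)) = g\<close> by simp
  qed
  show "scal C c (padd C f g) = padd C (scal C c f) (scal C c g)"
    if fg: "f \<in> hom C X Y" "g \<in> hom C X Y"
  proof -
    interpret vectorspace class_ring "hom_space C X Y" by (rule V[OF fg(1)])
    show ?thesis using smult_r_distr[of c f g] fg by simp
  qed
qed

lemma linear_maps_add:
  assumes "T \<in> linear_maps (hom_space C X Y) (hom_space C Z W)" "f \<in> hom C X Y" "g \<in> hom C X Y"
  shows "T (padd C f g) = padd C (T f) (T g)"
  using LinearCombinations.module_hom_add[OF assms(1)] assms(2,3) by simp

lemma linear_maps_scal:
  assumes "T \<in> linear_maps (hom_space C X Y) (hom_space C Z W)" "f \<in> hom C X Y"
  shows "T (scal C c f) = scal C c (T f)"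
  using LinearCombinations.module_hom_smult[OF assms(1)] assms(2) by simp

lemma linear_maps_zarr:
  assumes "T \<in> linear_maps (hom_space C X Y) (hom_space C Z W)" "X \<in> obj C" "Y \<in> obj C"
  shows "T (zarr C X Y) = zarr C Z W"
proof -
  have z: "zarr C X Y \<in> hom C X Y" by (rule zarr_hom[OF assms(2,3)])
  have "T (zarr C X Y) = T (scal C 0 (zarr C X Y))" using scal_zero[OF z] by simp
  also have "\<dots> = scal C 0 (T (zarr C X Y))" by (rule linear_maps_scal[OF assms(1) z])
  also have "\<dots> = zarr C Z W"
    using linear_maps_closed[OF assms(1)] z by (intro scal_zero) simp
  finally show ?thesis .
qed

lemmas padd_cmp = linear_maps_add[OF cmp_left_maps]
  and scal_cmp = linear_maps_scal[OF cmp_left_maps]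
  and zarr_cmp = linear_maps_zarr[OF cmp_left_maps]
  and cmp_padd = linear_maps_add[OF cmp_right_maps]
  and cmp_scal = linear_maps_scal[OF cmp_right_maps]
  and cmp_zarr = linear_maps_zarr[OF cmp_right_maps]

lemma scal_maps:
  assumes "X \<in> obj C" "Y \<in> obj C"
  shows "scal C c \<in> linear_maps (hom_space C X Y) (hom_space C X Y)"
  unfolding LinearCombinations.module_hom_def
  by (auto simp: scal_hom scal_padd scal_scal mult.commute)

lemma cmp_bilinear:
  "X \<in> obj C \<Longrightarrow> bilinear_op (hom_space C X X) (\<cdot>)"
  unfolding bilinear_op_def by (auto intro: cmp_left_maps cmp_right_maps)

end

context linear_monoidal_category
begin

lemma tarr_left_maps:
  assumes "f \<in> hom C X' Y'" "X \<in> obj C" "Y \<in> obj C"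
  shows "(\<lambda>g. g \<boxtimes> f) \<in> linear_maps (hom_space C X Y) (hom_space C (X \<boxtimes>\<^sub>o X') (Y \<boxtimes>\<^sub>o Y'))"
proof -
  interpret linear_map class_ring "hom_space C X Y" "hom_space C (X \<boxtimes>\<^sub>o X') (Y \<boxtimes>\<^sub>o Y')" "\<lambda>g. g \<boxtimes> f"
    by (rule tarr_linear_left[OF assms])
  show ?thesis by (rule f_hom)
qed

lemma tarr_right_maps:
  assumes "f \<in> hom C X Y" "X' \<in> obj C" "Y' \<in> obj C"
  shows "(\<lambda>g. f \<boxtimes> g) \<in> linear_maps (hom_space C X' Y') (hom_space C (X \<boxtimes>\<^sub>o X') (Y \<boxtimes>\<^sub>o Y'))"
proof -
  interpret linear_map class_ring "hom_space C X' Y'" "hom_space C (X \<boxtimes>\<^sub>o X') (Y \<boxtimes>\<^sub>o Y')" "\<lambda>g. f \<boxtimes> g"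
    by (rule tarr_linear_right[OF assms])
  show ?thesis by (rule f_hom)
qed

lemma hom_arr: "f \<in> hom C X Y \<Longrightarrow> f \<in> arr C"
  by (simp add: hom_def)

lemma tarr_split_left:
  assumes "f \<in> hom C X Y" "g \<in> hom C X' Y'"
  shows "f \<boxtimes> g = (f \<boxtimes> idm C Y') \<cdot> (idm C X \<boxtimes> g)"
  using interchange[OF idm_hom assms(1) assms(2) idm_hom] assms hom_obj
  by (metis cmp_idm_left cmp_idm_right)

lemma tarr_split_right:
  assumes "f \<in> hom C X Y" "g \<in> hom C X' Y'"
  shows "f \<boxtimes> g = (idm C Y \<boxtimes> g) \<cdot> (f \<boxtimes> idm C X')"
  using interchange[OF assms(1) idm_hom idm_hom assms(2)] assms hom_obj
  by (metis cmp_idm_left cmp_idm_right)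

text \<open>Since \<open>X \<otimes> 1 = X\<close> holds strictly, tensoring \<open>f\<close> with a state \<open>k : 1 \<rightarrow> Z\<close> is the same as creating
  the state after or before \<open>f\<close>.\<close>
lemma tarr_state_right:
  assumes "f \<in> hom C X Y" "k \<in> hom C (unt C) Z"
  shows "f \<boxtimes> k = (idm C Y \<boxtimes> k) \<cdot> f" "f \<boxtimes> k = (f \<boxtimes> idm C Z) \<cdot> (idm C X \<boxtimes> k)"
  using tarr_split_right[OF assms] tarr_split_left[OF assms] tarr_unt_right[OF hom_arr[OF assms(1)]]
  by auto

lemma tarr_state_left:
  assumes "f \<in> hom C X Y" "k \<in> hom C (unt C) Z"
  shows "k \<boxtimes> f = (k \<boxtimes> idm C Y) \<cdot> f" "k \<boxtimes> f = (idm C Z \<boxtimes> f) \<cdot> (k \<boxtimes> idm C X)"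
  using tarr_split_left[OF assms(2,1)] tarr_split_right[OF assms(2,1)]
    tarr_unt_left[OF hom_arr[OF assms(1)]] by auto

text \<open>The dual arrow is the adjoint with respect to the evaluations: evaluating against \<open>X\<close> straightens
  the coevaluation of \<open>X\<close> in \<open>f\<^sup>*\<close> by the zigzag identity, which leaves the evaluation of \<open>Y\<close>.\<close>
lemma dual_arr_pairing:
  assumes dX: "is_left_dual C X dX" and dY: "is_left_dual C Y dY" and f: "f \<in> hom C X Y"
  shows "dual_arr C dX dY f \<in> hom C (dobj dY) (dobj dX)"
    and "dev dX \<cdot> (dual_arr C dX dY f \<boxtimes> idm C X) = dev dY \<cdot> (idm C (dobj dY) \<boxtimes> f)"
proof -
  define V W where "V = dobj dX" and "W = dobj dY"
  have X: "X \<in> obj C" and V: "V \<in> obj C" and evX: "dev dX \<in> hom C (V \<boxtimes>\<^sub>o X) (unt C)"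
    and coX: "dcoev dX \<in> hom C (unt C) (X \<boxtimes>\<^sub>o V)"
    and zigzag: "(idm C X \<boxtimes> dev dX) \<cdot> (dcoev dX \<boxtimes> idm C X) = idm C X"
    using dX by (auto simp: is_left_dual_def V_def)
  have Y: "Y \<in> obj C" and W: "W \<in> obj C" and evY: "dev dY \<in> hom C (W \<boxtimes>\<^sub>o Y) (unt C)"
    using dY by (auto simp: is_left_dual_def W_def)
  note iX = idm_hom[OF X] and iV = idm_hom[OF V] and iW = idm_hom[OF W]
  note objs = tobj_obj[OF V X] tobj_obj[OF W X] tobj_obj[OF W Y] X V Y W
  note assocs = tobj_assoc tobj_obj objs tobj_unt_left tobj_unt_right
  (* h1, h2, h3 are the layers of the dual arrow, read in the order of composition *)
  define h1 where "h1 = idm C W \<boxtimes> dcoev dX"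
  define h2 where "h2 = (idm C W \<boxtimes> f) \<boxtimes> idm C V"
  define h3 where "h3 = dev dY \<boxtimes> idm C V"
  have h1: "h1 \<in> hom C W (W \<boxtimes>\<^sub>o (X \<boxtimes>\<^sub>o V))"
    using tarr_hom[OF iW coX] by (simp add: h1_def assocs)
  have h2: "h2 \<in> hom C (W \<boxtimes>\<^sub>o (X \<boxtimes>\<^sub>o V)) (W \<boxtimes>\<^sub>o (Y \<boxtimes>\<^sub>o V))"
    using tarr_hom[OF tarr_hom[OF iW f] iV] by (simp add: h2_def assocs)
  have h3: "h3 \<in> hom C (W \<boxtimes>\<^sub>o (Y \<boxtimes>\<^sub>o V)) V"
    using tarr_hom[OF evY iV] by (simp add: h3_def assocs)
  have g: "dual_arr C dX dY f = h3 \<cdot> (h2 \<cdot> h1)"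
    using tarr_assoc[OF hom_arr[OF iW] hom_arr[OF f] hom_arr[OF iV]]
    by (simp add: dual_arr_def h1_def h2_def h3_def V_def W_def)
  show "dual_arr C dX dY f \<in> hom C (dobj dY) (dobj dX)"
    unfolding g V_def[symmetric] W_def[symmetric] by (rule cmp_hom[OF cmp_hom[OF h1 h2] h3])
  have H1: "h1 \<boxtimes> idm C X \<in> hom C (W \<boxtimes>\<^sub>o X) (W \<boxtimes>\<^sub>o (X \<boxtimes>\<^sub>o (V \<boxtimes>\<^sub>o X)))"
    using tarr_hom[OF h1 iX] by (simp add: assocs)
  have H2: "h2 \<boxtimes> idm C X \<in> hom C (W \<boxtimes>\<^sub>o (X \<boxtimes>\<^sub>o (V \<boxtimes>\<^sub>o X))) (W \<boxtimes>\<^sub>o (Y \<boxtimes>\<^sub>o (V \<boxtimes>\<^sub>o X)))"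
    using tarr_hom[OF h2 iX] by (simp add: assocs)
  have H3: "h3 \<boxtimes> idm C X \<in> hom C (W \<boxtimes>\<^sub>o (Y \<boxtimes>\<^sub>o (V \<boxtimes>\<^sub>o X))) (V \<boxtimes>\<^sub>o X)"
    using tarr_hom[OF h3 iX] by (simp add: assocs)
  have EY: "idm C (W \<boxtimes>\<^sub>o Y) \<boxtimes> dev dX \<in> hom C (W \<boxtimes>\<^sub>o (Y \<boxtimes>\<^sub>o (V \<boxtimes>\<^sub>o X))) (W \<boxtimes>\<^sub>o Y)"
    using tarr_hom[OF idm_hom[OF objs(3)] evX] by (simp add: assocs)
  have EX: "idm C (W \<boxtimes>\<^sub>o X) \<boxtimes> dev dX \<in> hom C (W \<boxtimes>\<^sub>o (X \<boxtimes>\<^sub>o (V \<boxtimes>\<^sub>o X))) (W \<boxtimes>\<^sub>o X)"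
    using tarr_hom[OF idm_hom[OF objs(2)] evX] by (simp add: assocs)
  have Wf: "idm C W \<boxtimes> f \<in> hom C (W \<boxtimes>\<^sub>o X) (W \<boxtimes>\<^sub>o Y)" by (rule tarr_hom[OF iW f])
  have "(h3 \<cdot> (h2 \<cdot> h1)) \<boxtimes> idm C X = (h3 \<boxtimes> idm C X) \<cdot> ((h2 \<boxtimes> idm C X) \<cdot> (h1 \<boxtimes> idm C X))"
    using interchange[OF cmp_hom[OF h1 h2] h3 iX iX] interchange[OF h1 h2 iX iX] cmp_idm_left[OF iX]
    by simp
  then have "dev dX \<cdot> (dual_arr C dX dY f \<boxtimes> idm C X)
      = (dev dX \<cdot> (h3 \<boxtimes> idm C X)) \<cdot> ((h2 \<boxtimes> idm C X) \<cdot> (h1 \<boxtimes> idm C X))"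
    using g cmp_assoc[OF cmp_hom[OF H1 H2] H3 evX] by simp
  also have "dev dX \<cdot> (h3 \<boxtimes> idm C X) = dev dY \<cdot> (idm C (W \<boxtimes>\<^sub>o Y) \<boxtimes> dev dX)"
  proof -
    have "h3 \<boxtimes> idm C X = dev dY \<boxtimes> idm C (V \<boxtimes>\<^sub>o X)"
      using tarr_assoc[OF hom_arr[OF evY] hom_arr[OF iV] hom_arr[OF iX]] tarr_idm[OF V X]
      by (simp add: h3_def)
    then show ?thesis
      using tarr_split_left[OF evY evX] tarr_split_right[OF evY evX]
        tarr_unt_left[OF hom_arr[OF evX]] tarr_unt_right[OF hom_arr[OF evY]] by simp
  qed
  also have "(dev dY \<cdot> (idm C (W \<boxtimes>\<^sub>o Y) \<boxtimes> dev dX)) \<cdot> ((h2 \<boxtimes> idm C X) \<cdot> (h1 \<boxtimes> idm C X))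
      = dev dY \<cdot> (((idm C (W \<boxtimes>\<^sub>o Y) \<boxtimes> dev dX) \<cdot> (h2 \<boxtimes> idm C X)) \<cdot> (h1 \<boxtimes> idm C X))"
    using cmp_assoc[OF cmp_hom[OF H1 H2] EY evY] cmp_assoc[OF H1 H2 EY] by simp
  also have "(idm C (W \<boxtimes>\<^sub>o Y) \<boxtimes> dev dX) \<cdot> (h2 \<boxtimes> idm C X)
      = (idm C W \<boxtimes> f) \<cdot> (idm C (W \<boxtimes>\<^sub>o X) \<boxtimes> dev dX)"
  proof -
    have "h2 \<boxtimes> idm C X = (idm C W \<boxtimes> f) \<boxtimes> idm C (V \<boxtimes>\<^sub>o X)"
      using tarr_assoc[OF hom_arr[OF Wf] hom_arr[OF iV] hom_arr[OF iX]] tarr_idm[OF V X]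
      by (simp add: h2_def)
    then show ?thesis
      using tarr_split_right[OF Wf evX] tarr_split_left[OF Wf evX] tarr_unt_right[OF hom_arr[OF Wf]]
      by simp
  qed
  also have "((idm C W \<boxtimes> f) \<cdot> (idm C (W \<boxtimes>\<^sub>o X) \<boxtimes> dev dX)) \<cdot> (h1 \<boxtimes> idm C X)
      = (idm C W \<boxtimes> f) \<cdot> ((idm C (W \<boxtimes>\<^sub>o X) \<boxtimes> dev dX) \<cdot> (h1 \<boxtimes> idm C X))"
    by (rule cmp_assoc[OF H1 EX Wf])
  also have "(idm C (W \<boxtimes>\<^sub>o X) \<boxtimes> dev dX) \<cdot> (h1 \<boxtimes> idm C X) = idm C (W \<boxtimes>\<^sub>o X)"
  proof -
    have Xe: "idm C X \<boxtimes> dev dX \<in> hom C (X \<boxtimes>\<^sub>o (V \<boxtimes>\<^sub>o X)) X"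
      using tarr_hom[OF iX evX] by (simp add: assocs)
    have cX: "dcoev dX \<boxtimes> idm C X \<in> hom C X (X \<boxtimes>\<^sub>o (V \<boxtimes>\<^sub>o X))"
      using tarr_hom[OF coX iX] by (simp add: assocs)
    have "idm C (W \<boxtimes>\<^sub>o X) \<boxtimes> dev dX = idm C W \<boxtimes> (idm C X \<boxtimes> dev dX)"
      using tarr_assoc[OF hom_arr[OF iW] hom_arr[OF iX] hom_arr[OF evX]] tarr_idm[OF W X] by simp
    moreover have "h1 \<boxtimes> idm C X = idm C W \<boxtimes> (dcoev dX \<boxtimes> idm C X)"
      using tarr_assoc[OF hom_arr[OF iW] hom_arr[OF coX] hom_arr[OF iX]] by (simp add: h1_def)
    ultimately show ?thesis
      using interchange[OF iW iW cX Xe] cmp_idm_left[OF iW] zigzag tarr_idm[OF W X] by simp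
  qed
  finally show "dev dX \<cdot> (dual_arr C dX dY f \<boxtimes> idm C X) = dev dY \<cdot> (idm C (dobj dY) \<boxtimes> f)"
    using cmp_idm_right[OF Wf] by (simp add: W_def)
qed

end

section \<open>The product of arrows into a Frobenius algebra\<close>

locale frobenius_object = linear_monoidal_category C for C :: "('o, 'a) lin_moncat" (structure) +
  fixes F :: "('o, 'a) frob"
  assumes frobenius: "frobenius_algebra C F"
begin

abbreviation X where "X \<equiv> fobj F"
abbreviation \<mu> where "\<mu> \<equiv> fmul F"
abbreviation \<delta> where "\<delta> \<equiv> fcomul F"
abbreviation e where "e \<equiv> funit F"
abbreviation \<epsilon> where "\<epsilon> \<equiv> fcounit F"
abbreviation I where "I \<equiv> idm C X"

lemma X_obj: "X \<in> obj C"
  and mul_arr: "\<mu> \<in> hom C (X \<boxtimes>\<^sub>o X) X"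
  and unit_hom: "e \<in> hom C (unt C) X"
  and comul_hom: "\<delta> \<in> hom C X (X \<boxtimes>\<^sub>o X)"
  and counit_hom: "\<epsilon> \<in> hom C X (unt C)"
  and mul_assoc_arr: "\<mu> \<cdot> (\<mu> \<boxtimes> I) = \<mu> \<cdot> (I \<boxtimes> \<mu>)"
  and mul_unit_left: "\<mu> \<cdot> (e \<boxtimes> I) = I"
  and mul_unit_right: "\<mu> \<cdot> (I \<boxtimes> e) = I"
  and counit_left: "(\<epsilon> \<boxtimes> I) \<cdot> \<delta> = I"
  and counit_right: "(I \<boxtimes> \<epsilon>) \<cdot> \<delta> = I"
  and frobenius_left: "(I \<boxtimes> \<mu>) \<cdot> (\<delta> \<boxtimes> I) = \<delta> \<cdot> \<mu>"
  and frobenius_right: "(\<mu> \<boxtimes> I) \<cdot> (I \<boxtimes> \<delta>) = \<delta> \<cdot> \<mu>"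
  using frobenius by (auto simp: frobenius_algebra_def Let_def)

definition copair where "copair = \<delta> \<cdot> e"

text \<open>With this product the arrows into \<open>X\<close> behave like elements of an algebra: it is associative,
  \<open>e\<close> is its unit, \<open>I\<close> plays the role of a variable, and tensor products of arrows substitute into
  it.  String diagrams thereby become words.\<close>
definition times (infixl \<open>\<star>\<close> 70) where "u \<star> v = \<mu> \<cdot> (u \<boxtimes> v)"

lemma I_hom: "I \<in> hom C X X" by (rule idm_hom[OF X_obj])

lemma XX_obj: "X \<boxtimes>\<^sub>o X \<in> obj C" by (rule tobj_obj[OF X_obj X_obj])

lemma copair_hom: "copair \<in> hom C (unt C) (X \<boxtimes>\<^sub>o X)"
  unfolding copair_def by (rule cmp_hom[OF unit_hom comul_hom])

lemma times_hom: "u \<in> hom C Y X \<Longrightarrow> v \<in> hom C Z X \<Longrightarrow> u \<star> v \<in> hom C (Y \<boxtimes>\<^sub>o Z) X"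
  unfolding times_def by (rule cmp_hom[OF tarr_hom mul_arr])

lemma times_cmp:
  assumes "u \<in> hom C Y X" "v \<in> hom C Z X" "s \<in> hom C Y' Y" "t \<in> hom C Z' Z"
  shows "(u \<star> v) \<cdot> (s \<boxtimes> t) = (u \<cdot> s) \<star> (v \<cdot> t)"
  unfolding times_def
  using cmp_assoc[OF tarr_hom[OF assms(3,4)] tarr_hom[OF assms(1,2)] mul_arr]
    interchange[OF assms(3,1,4,2)] by simp

lemma times_assoc:
  assumes u: "u \<in> hom C Y X" and v: "v \<in> hom C Z X" and w: "w \<in> hom C W X"
  shows "(u \<star> v) \<star> w = u \<star> (v \<star> w)"
proof -
  have t: "u \<boxtimes> (v \<boxtimes> w) \<in> hom C (Y \<boxtimes>\<^sub>o (Z \<boxtimes>\<^sub>o W)) (X \<boxtimes>\<^sub>o (X \<boxtimes>\<^sub>o X))"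
    by (intro tarr_hom u v w)
  have mI: "\<mu> \<boxtimes> I \<in> hom C (X \<boxtimes>\<^sub>o (X \<boxtimes>\<^sub>o X)) (X \<boxtimes>\<^sub>o X)"
    using tarr_hom[OF mul_arr I_hom] tobj_assoc[OF X_obj X_obj X_obj] by simp
  have Im: "I \<boxtimes> \<mu> \<in> hom C (X \<boxtimes>\<^sub>o (X \<boxtimes>\<^sub>o X)) (X \<boxtimes>\<^sub>o X)"
    by (rule tarr_hom[OF I_hom mul_arr])
  have "(\<mu> \<cdot> (u \<boxtimes> v)) \<boxtimes> w = (\<mu> \<boxtimes> I) \<cdot> ((u \<boxtimes> v) \<boxtimes> w)"
    using interchange[OF tarr_hom[OF u v] mul_arr w I_hom] cmp_idm_left[OF w] by simp
  also have "\<dots> = (\<mu> \<boxtimes> I) \<cdot> (u \<boxtimes> (v \<boxtimes> w))"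
    using tarr_assoc[OF hom_arr[OF u] hom_arr[OF v] hom_arr[OF w]] by simp
  finally have "(u \<star> v) \<star> w = (\<mu> \<cdot> (\<mu> \<boxtimes> I)) \<cdot> (u \<boxtimes> (v \<boxtimes> w))"
    using cmp_assoc[OF t mI mul_arr] by (simp add: times_def)
  also have "\<dots> = \<mu> \<cdot> ((I \<boxtimes> \<mu>) \<cdot> (u \<boxtimes> (v \<boxtimes> w)))"
    using cmp_assoc[OF t Im mul_arr] by (simp add: mul_assoc_arr)
  also have "(I \<boxtimes> \<mu>) \<cdot> (u \<boxtimes> (v \<boxtimes> w)) = u \<boxtimes> (\<mu> \<cdot> (v \<boxtimes> w))"
    using interchange[OF u I_hom tarr_hom[OF v w] mul_arr] cmp_idm_left[OF u] by simp
  finally show ?thesis by (simp add: times_def)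
qed

lemma unit_times:
  assumes u: "u \<in> hom C Y X"
  shows "e \<star> u = u" "u \<star> e = u"
proof -
  have "e \<star> u = \<mu> \<cdot> ((e \<boxtimes> I) \<cdot> u)"
    unfolding times_def tarr_state_left(1)[OF u unit_hom] ..
  also have "\<dots> = (\<mu> \<cdot> (e \<boxtimes> I)) \<cdot> u"
    using cmp_assoc[OF u _ mul_arr] tarr_hom[OF unit_hom I_hom] tobj_unt_left[OF X_obj] by simp
  finally show "e \<star> u = u" by (simp add: mul_unit_left cmp_idm_left[OF u])
  have "u \<star> e = \<mu> \<cdot> ((I \<boxtimes> e) \<cdot> u)"
    unfolding times_def tarr_state_right(1)[OF u unit_hom] ..
  also have "\<dots> = (\<mu> \<cdot> (I \<boxtimes> e)) \<cdot> u"
    using cmp_assoc[OF u _ mul_arr] tarr_hom[OF I_hom unit_hom] tobj_unt_right[OF X_obj] by simp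
  finally show "u \<star> e = u" by (simp add: mul_unit_right cmp_idm_left[OF u])
qed

lemma I_times_I: "I \<star> I = \<mu>"
  unfolding times_def using tarr_idm[OF X_obj X_obj] cmp_idm_right[OF mul_arr] by simp

lemma copair_right_hom: "I \<boxtimes> copair \<in> hom C X (X \<boxtimes>\<^sub>o (X \<boxtimes>\<^sub>o X))"
  using tarr_hom[OF I_hom copair_hom] tobj_unt_right[OF X_obj] by simp

lemma copair_left_hom: "copair \<boxtimes> I \<in> hom C X (X \<boxtimes>\<^sub>o (X \<boxtimes>\<^sub>o X))"
  using tarr_hom[OF copair_hom I_hom] tobj_unt_left[OF X_obj] tobj_assoc[OF X_obj X_obj X_obj] by simp

text \<open>The Frobenius relations express the comultiplication through the product and the copairing;
  this is what makes the copairing central, in the sense that \<open>\<Sum> x x\<^sub>i \<otimes> x\<^sup>i = \<Sum> x\<^sub>i \<otimes> x\<^sup>i x\<close>.\<close>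
lemma comul_eq_right: "(\<mu> \<boxtimes> I) \<cdot> (I \<boxtimes> copair) = \<delta>"
proof -
  have Ie: "I \<boxtimes> e \<in> hom C X (X \<boxtimes>\<^sub>o X)"
    using tarr_hom[OF I_hom unit_hom] tobj_unt_right[OF X_obj] by simp
  have Id: "I \<boxtimes> \<delta> \<in> hom C (X \<boxtimes>\<^sub>o X) (X \<boxtimes>\<^sub>o (X \<boxtimes>\<^sub>o X))" by (rule tarr_hom[OF I_hom comul_hom])
  have mI: "\<mu> \<boxtimes> I \<in> hom C (X \<boxtimes>\<^sub>o (X \<boxtimes>\<^sub>o X)) (X \<boxtimes>\<^sub>o X)"
    using tarr_hom[OF mul_arr I_hom] tobj_assoc[OF X_obj X_obj X_obj] by simp
  have "I \<boxtimes> copair = (I \<boxtimes> \<delta>) \<cdot> (I \<boxtimes> e)"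
    unfolding copair_def
    using interchange[OF I_hom I_hom unit_hom comul_hom] cmp_idm_left[OF I_hom] by simp
  then have "(\<mu> \<boxtimes> I) \<cdot> (I \<boxtimes> copair) = (\<delta> \<cdot> \<mu>) \<cdot> (I \<boxtimes> e)"
    using cmp_assoc[OF Ie Id mI] by (simp add: frobenius_right)
  also have "\<dots> = \<delta>"
    using cmp_assoc[OF Ie mul_arr comul_hom] mul_unit_right cmp_idm_right[OF comul_hom] by simp
  finally show ?thesis .
qed

lemma comul_eq_left: "(I \<boxtimes> \<mu>) \<cdot> (copair \<boxtimes> I) = \<delta>"
proof -
  have eI: "e \<boxtimes> I \<in> hom C X (X \<boxtimes>\<^sub>o X)"
    using tarr_hom[OF unit_hom I_hom] tobj_unt_left[OF X_obj] by simp
  have dI: "\<delta> \<boxtimes> I \<in> hom C (X \<boxtimes>\<^sub>o X) (X \<boxtimes>\<^sub>o (X \<boxtimes>\<^sub>o X))"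
    using tarr_hom[OF comul_hom I_hom] tobj_assoc[OF X_obj X_obj X_obj] by simp
  have Im: "I \<boxtimes> \<mu> \<in> hom C (X \<boxtimes>\<^sub>o (X \<boxtimes>\<^sub>o X)) (X \<boxtimes>\<^sub>o X)"
    by (rule tarr_hom[OF I_hom mul_arr])
  have "copair \<boxtimes> I = (\<delta> \<boxtimes> I) \<cdot> (e \<boxtimes> I)"
    unfolding copair_def
    using interchange[OF unit_hom comul_hom I_hom I_hom] cmp_idm_left[OF I_hom] by simp
  then have "(I \<boxtimes> \<mu>) \<cdot> (copair \<boxtimes> I) = (\<delta> \<cdot> \<mu>) \<cdot> (e \<boxtimes> I)"
    using cmp_assoc[OF eI dI Im] by (simp add: frobenius_left)
  also have "\<dots> = \<delta>"
    using cmp_assoc[OF eI mul_arr comul_hom] mul_unit_left cmp_idm_right[OF comul_hom] by simp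
  finally show ?thesis .
qed

lemma times_comul_right:
  assumes u: "u \<in> hom C X X" and v: "v \<in> hom C X X"
  shows "(u \<star> v) \<cdot> \<delta> = ((u \<cdot> \<mu>) \<star> v) \<cdot> (I \<boxtimes> copair)"
proof -
  have mI: "\<mu> \<boxtimes> I \<in> hom C (X \<boxtimes>\<^sub>o (X \<boxtimes>\<^sub>o X)) (X \<boxtimes>\<^sub>o X)"
    using tarr_hom[OF mul_arr I_hom] tobj_assoc[OF X_obj X_obj X_obj] by simp
  have "(u \<star> v) \<cdot> \<delta> = ((u \<star> v) \<cdot> (\<mu> \<boxtimes> I)) \<cdot> (I \<boxtimes> copair)"
    using cmp_assoc[OF copair_right_hom mI times_hom[OF u v]] comul_eq_right by simp
  then show ?thesis using times_cmp[OF u v mul_arr I_hom] cmp_idm_right[OF v] by simp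
qed

lemma times_comul_left:
  assumes u: "u \<in> hom C X X" and v: "v \<in> hom C X X"
  shows "(u \<star> v) \<cdot> \<delta> = (u \<star> (v \<cdot> \<mu>)) \<cdot> (copair \<boxtimes> I)"
proof -
  have Im: "I \<boxtimes> \<mu> \<in> hom C (X \<boxtimes>\<^sub>o (X \<boxtimes>\<^sub>o X)) (X \<boxtimes>\<^sub>o X)"
    by (rule tarr_hom[OF I_hom mul_arr])
  have "(u \<star> v) \<cdot> \<delta> = ((u \<star> v) \<cdot> (I \<boxtimes> \<mu>)) \<cdot> (copair \<boxtimes> I)"
    using cmp_assoc[OF copair_left_hom Im times_hom[OF u v]] comul_eq_left by simp
  then show ?thesis using times_cmp[OF u v I_hom mul_arr] cmp_idm_right[OF u] by simp
qed

lemma times_copair_right: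
  assumes u: "u \<in> hom C X X" and t: "t \<in> hom C (X \<boxtimes>\<^sub>o X) X"
  shows "(u \<star> t) \<cdot> (I \<boxtimes> copair) = u \<star> (t \<cdot> copair)"
  using times_cmp[OF u t I_hom copair_hom] cmp_idm_right[OF u] by simp

lemma times_copair_left:
  assumes u: "u \<in> hom C X X" and t: "t \<in> hom C (X \<boxtimes>\<^sub>o X) X"
  shows "(t \<star> u) \<cdot> (copair \<boxtimes> I) = (t \<cdot> copair) \<star> u"
  using times_cmp[OF t u copair_hom I_hom] cmp_idm_right[OF u] by simp

text \<open>In elements: replacing \<open>x\<close> by \<open>f x\<close> in \<open>\<Sum> v(x, x\<^sub>i) w(x\<^sup>i)\<close> is composition with \<open>f\<close>.\<close>
lemma times_copair_slide:
  assumes v: "v \<in> hom C (X \<boxtimes>\<^sub>o X) X" and w: "w \<in> hom C X X" and f: "f \<in> hom C X X"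
  shows "((v \<cdot> (f \<boxtimes> I)) \<star> w) \<cdot> (I \<boxtimes> copair) = ((v \<star> w) \<cdot> (I \<boxtimes> copair)) \<cdot> f"
proof -
  have fI: "f \<boxtimes> I \<in> hom C (X \<boxtimes>\<^sub>o X) (X \<boxtimes>\<^sub>o X)" by (rule tarr_hom[OF f I_hom])
  have fII: "(f \<boxtimes> I) \<boxtimes> I \<in> hom C (X \<boxtimes>\<^sub>o (X \<boxtimes>\<^sub>o X)) (X \<boxtimes>\<^sub>o (X \<boxtimes>\<^sub>o X))"
    using tarr_hom[OF fI I_hom] tobj_assoc[OF X_obj X_obj X_obj] by simp
  have vw: "v \<star> w \<in> hom C (X \<boxtimes>\<^sub>o (X \<boxtimes>\<^sub>o X)) X"
    using times_hom[OF v w] tobj_assoc[OF X_obj X_obj X_obj] by simp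
  have "(f \<boxtimes> I) \<boxtimes> I = f \<boxtimes> idm C (X \<boxtimes>\<^sub>o X)"
    using tarr_assoc[OF hom_arr[OF f] hom_arr[OF I_hom] hom_arr[OF I_hom]] tarr_idm[OF X_obj X_obj]
    by simp
  then have slide: "((f \<boxtimes> I) \<boxtimes> I) \<cdot> (I \<boxtimes> copair) = (I \<boxtimes> copair) \<cdot> f"
    using tarr_state_right[OF f copair_hom] by simp
  have "((v \<cdot> (f \<boxtimes> I)) \<star> w) \<cdot> (I \<boxtimes> copair) = ((v \<star> w) \<cdot> ((f \<boxtimes> I) \<boxtimes> I)) \<cdot> (I \<boxtimes> copair)"
    using times_cmp[OF v w fI I_hom] cmp_idm_right[OF w] by simp
  also have "\<dots> = (v \<star> w) \<cdot> ((I \<boxtimes> copair) \<cdot> f)"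
    using cmp_assoc[OF copair_right_hom fII vw] slide by simp
  also have "\<dots> = ((v \<star> w) \<cdot> (I \<boxtimes> copair)) \<cdot> f"
    using cmp_assoc[OF f copair_right_hom vw] by simp
  finally show ?thesis .
qed

text \<open>The Frobenius pairing is nondegenerate: the copairing recovers \<open>f\<close> from \<open>\<epsilon> (f \<star> I)\<close>.\<close>
lemma eq_via_pairing_right:
  assumes f: "f \<in> hom C Y X" and g: "g \<in> hom C Y X" and eq: "\<epsilon> \<cdot> (f \<star> I) = \<epsilon> \<cdot> (g \<star> I)"
  shows "f = g"
proof -
  have "((\<epsilon> \<cdot> (f \<star> I)) \<boxtimes> I) \<cdot> (idm C Y \<boxtimes> copair) = f" if f: "f \<in> hom C Y X" for f
  proof -
    have Y: "Y \<in> obj C" by (rule hom_obj[OF f])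
    have fI: "f \<boxtimes> I \<in> hom C (Y \<boxtimes>\<^sub>o X) (X \<boxtimes>\<^sub>o X)" by (rule tarr_hom[OF f I_hom])
    have fII: "(f \<boxtimes> I) \<boxtimes> I \<in> hom C (Y \<boxtimes>\<^sub>o (X \<boxtimes>\<^sub>o X)) (X \<boxtimes>\<^sub>o (X \<boxtimes>\<^sub>o X))"
      using tarr_hom[OF fI I_hom] tobj_assoc[OF X_obj X_obj X_obj] tobj_assoc[OF Y X_obj X_obj] by simp
    have mI: "\<mu> \<boxtimes> I \<in> hom C (X \<boxtimes>\<^sub>o (X \<boxtimes>\<^sub>o X)) (X \<boxtimes>\<^sub>o X)"
      using tarr_hom[OF mul_arr I_hom] tobj_assoc[OF X_obj X_obj X_obj] by simp
    have eI: "\<epsilon> \<boxtimes> I \<in> hom C (X \<boxtimes>\<^sub>o X) X"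
      using tarr_hom[OF counit_hom I_hom] tobj_unt_left[OF X_obj] by simp
    have Yk: "idm C Y \<boxtimes> copair \<in> hom C Y (Y \<boxtimes>\<^sub>o (X \<boxtimes>\<^sub>o X))"
      using tarr_hom[OF idm_hom[OF Y] copair_hom] tobj_unt_right[OF Y] by simp
    have "(f \<boxtimes> I) \<boxtimes> I = f \<boxtimes> idm C (X \<boxtimes>\<^sub>o X)"
      using tarr_assoc[OF hom_arr[OF f] hom_arr[OF I_hom] hom_arr[OF I_hom]] tarr_idm[OF X_obj X_obj]
      by simp
    then have slide: "((f \<boxtimes> I) \<boxtimes> I) \<cdot> (idm C Y \<boxtimes> copair) = (I \<boxtimes> copair) \<cdot> f"
      using tarr_state_right[OF f copair_hom] by simp
    have "(\<epsilon> \<cdot> (f \<star> I)) \<boxtimes> I = (\<epsilon> \<boxtimes> I) \<cdot> ((\<mu> \<boxtimes> I) \<cdot> ((f \<boxtimes> I) \<boxtimes> I))"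
      using interchange[OF times_hom[OF f I_hom] counit_hom I_hom I_hom]
        interchange[OF fI mul_arr I_hom I_hom] cmp_idm_left[OF I_hom] by (simp add: times_def)
    then have "((\<epsilon> \<cdot> (f \<star> I)) \<boxtimes> I) \<cdot> (idm C Y \<boxtimes> copair)
        = (\<epsilon> \<boxtimes> I) \<cdot> ((\<mu> \<boxtimes> I) \<cdot> ((I \<boxtimes> copair) \<cdot> f))"
      using cmp_assoc[OF Yk cmp_hom[OF fII mI] eI] cmp_assoc[OF Yk fII mI] slide by simp
    also have "\<dots> = ((\<epsilon> \<boxtimes> I) \<cdot> \<delta>) \<cdot> f"
      using cmp_assoc[OF f copair_right_hom mI] cmp_assoc[OF f comul_hom eI] comul_eq_right by simp
    finally show ?thesis using counit_left cmp_idm_left[OF f] by simp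
  qed
  from trans[OF sym[OF this[OF f, unfolded eq]] this[OF g]] show ?thesis .
qed

lemma eq_via_pairing_left:
  assumes f: "f \<in> hom C Y X" and g: "g \<in> hom C Y X" and eq: "\<epsilon> \<cdot> (I \<star> f) = \<epsilon> \<cdot> (I \<star> g)"
  shows "f = g"
proof -
  have "(I \<boxtimes> (\<epsilon> \<cdot> (I \<star> f))) \<cdot> (copair \<boxtimes> idm C Y) = f" if f: "f \<in> hom C Y X" for f
  proof -
    have Y: "Y \<in> obj C" by (rule hom_obj[OF f])
    have fI: "I \<boxtimes> f \<in> hom C (X \<boxtimes>\<^sub>o Y) (X \<boxtimes>\<^sub>o X)" by (rule tarr_hom[OF I_hom f])
    have fII: "I \<boxtimes> (I \<boxtimes> f) \<in> hom C (X \<boxtimes>\<^sub>o (X \<boxtimes>\<^sub>o Y)) (X \<boxtimes>\<^sub>o (X \<boxtimes>\<^sub>o X))"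
      by (rule tarr_hom[OF I_hom fI])
    have Im: "I \<boxtimes> \<mu> \<in> hom C (X \<boxtimes>\<^sub>o (X \<boxtimes>\<^sub>o X)) (X \<boxtimes>\<^sub>o X)"
      by (rule tarr_hom[OF I_hom mul_arr])
    have Ie: "I \<boxtimes> \<epsilon> \<in> hom C (X \<boxtimes>\<^sub>o X) X"
      using tarr_hom[OF I_hom counit_hom] tobj_unt_right[OF X_obj] by simp
    have Yk: "copair \<boxtimes> idm C Y \<in> hom C Y (X \<boxtimes>\<^sub>o (X \<boxtimes>\<^sub>o Y))"
      using tarr_hom[OF copair_hom idm_hom[OF Y]] tobj_unt_left[OF Y] tobj_assoc[OF X_obj X_obj Y] by simp
    have "I \<boxtimes> (I \<boxtimes> f) = idm C (X \<boxtimes>\<^sub>o X) \<boxtimes> f"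
      using tarr_assoc[OF hom_arr[OF I_hom] hom_arr[OF I_hom] hom_arr[OF f]] tarr_idm[OF X_obj X_obj]
      by simp
    then have slide: "(I \<boxtimes> (I \<boxtimes> f)) \<cdot> (copair \<boxtimes> idm C Y) = (copair \<boxtimes> I) \<cdot> f"
      using tarr_state_left[OF f copair_hom] by simp
    have "I \<boxtimes> (\<epsilon> \<cdot> (I \<star> f)) = (I \<boxtimes> \<epsilon>) \<cdot> ((I \<boxtimes> \<mu>) \<cdot> (I \<boxtimes> (I \<boxtimes> f)))"
      using interchange[OF I_hom I_hom times_hom[OF I_hom f] counit_hom]
        interchange[OF I_hom I_hom fI mul_arr] cmp_idm_left[OF I_hom] by (simp add: times_def)
    then have "(I \<boxtimes> (\<epsilon> \<cdot> (I \<star> f))) \<cdot> (copair \<boxtimes> idm C Y)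
        = (I \<boxtimes> \<epsilon>) \<cdot> ((I \<boxtimes> \<mu>) \<cdot> ((copair \<boxtimes> I) \<cdot> f))"
      using cmp_assoc[OF Yk cmp_hom[OF fII Im] Ie] cmp_assoc[OF Yk fII Im] slide by simp
    also have "\<dots> = ((I \<boxtimes> \<epsilon>) \<cdot> \<delta>) \<cdot> f"
      using cmp_assoc[OF f copair_left_hom Im] cmp_assoc[OF f comul_hom Ie] comul_eq_left by simp
    finally show ?thesis using counit_right cmp_idm_left[OF f] by simp
  qed
  from trans[OF sym[OF this[OF f, unfolded eq]] this[OF g]] show ?thesis .
qed

lemma frob_dual_is_left_dual: "is_left_dual C X (frob_dual C F)"
proof -
  have mI: "\<mu> \<boxtimes> I \<in> hom C (X \<boxtimes>\<^sub>o (X \<boxtimes>\<^sub>o X)) (X \<boxtimes>\<^sub>o X)"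
    using tarr_hom[OF mul_arr I_hom] tobj_assoc[OF X_obj X_obj X_obj] by simp
  have eI: "\<epsilon> \<boxtimes> I \<in> hom C (X \<boxtimes>\<^sub>o X) X"
    using tarr_hom[OF counit_hom I_hom] tobj_unt_left[OF X_obj] by simp
  have Im: "I \<boxtimes> \<mu> \<in> hom C (X \<boxtimes>\<^sub>o (X \<boxtimes>\<^sub>o X)) (X \<boxtimes>\<^sub>o X)"
    by (rule tarr_hom[OF I_hom mul_arr])
  have Ie: "I \<boxtimes> \<epsilon> \<in> hom C (X \<boxtimes>\<^sub>o X) X"
    using tarr_hom[OF I_hom counit_hom] tobj_unt_right[OF X_obj] by simp
  have "(I \<boxtimes> (\<epsilon> \<cdot> \<mu>)) \<cdot> (copair \<boxtimes> I) = I"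
    using interchange[OF I_hom I_hom mul_arr counit_hom] cmp_idm_left[OF I_hom]
      cmp_assoc[OF copair_left_hom Im Ie] comul_eq_left counit_right by simp
  moreover have "((\<epsilon> \<cdot> \<mu>) \<boxtimes> I) \<cdot> (I \<boxtimes> copair) = I"
    using interchange[OF mul_arr counit_hom I_hom I_hom] cmp_idm_left[OF I_hom]
      cmp_assoc[OF copair_right_hom mI eI] comul_eq_right counit_left by simp
  ultimately show ?thesis
    using X_obj cmp_hom[OF mul_arr counit_hom] copair_hom
    by (simp add: is_left_dual_def frob_dual_def copair_def)
qed

lemma times_left_maps:
  assumes "v \<in> hom C Z X" "Y \<in> obj C"
  shows "(\<lambda>u. u \<star> v) \<in> linear_maps (hom_space C Y X) (hom_space C (Y \<boxtimes>\<^sub>o Z) X)"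
  unfolding times_def
  by (rule linear_maps_compose[OF tarr_left_maps[OF assms X_obj] cmp_right_maps[OF mul_arr]])
    (intro tobj_obj assms hom_obj[OF assms(1)])

lemma times_right_maps:
  assumes "u \<in> hom C Y X" "Z \<in> obj C"
  shows "(\<lambda>v. u \<star> v) \<in> linear_maps (hom_space C Z X) (hom_space C (Y \<boxtimes>\<^sub>o Z) X)"
  unfolding times_def
  by (rule linear_maps_compose[OF tarr_right_maps[OF assms X_obj] cmp_right_maps[OF mul_arr]])
    (intro tobj_obj assms hom_obj[OF assms(1)])

lemmas padd_times = linear_maps_add[OF times_left_maps]
  and scal_times = linear_maps_scal[OF times_left_maps]
  and zarr_times = linear_maps_zarr[OF times_left_maps]
  and times_padd = linear_maps_add[OF times_right_maps]
  and times_scal = linear_maps_scal[OF times_right_maps]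

section \<open>Idempotents of subalgebras\<close>

text \<open>An intrinsic form of the idempotents \<open>i i\<^sup>*\<close> of Frobenius subalgebras: selfadjoint for the
  Frobenius pairing, with an image that is closed under the product.\<close>
definition subalgebra_idempotent where
  "subalgebra_idempotent b \<longleftrightarrow> b \<in> hom C X X \<and> b \<cdot> b = b \<and>
     \<epsilon> \<cdot> (b \<star> I) = \<epsilon> \<cdot> (I \<star> b) \<and> b \<cdot> (b \<star> b) = b \<star> b"

lemma pairing_adjoint:
  assumes b: "subalgebra_idempotent b" and u: "u \<in> hom C Y X" and v: "v \<in> hom C Z X"
  shows "\<epsilon> \<cdot> ((b \<cdot> u) \<star> v) = \<epsilon> \<cdot> (u \<star> (b \<cdot> v))"
proof -
  have bh: "b \<in> hom C X X" and sym: "\<epsilon> \<cdot> (b \<star> I) = \<epsilon> \<cdot> (I \<star> b)"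
    using b by (auto simp: subalgebra_idempotent_def)
  have "\<epsilon> \<cdot> ((b \<cdot> u) \<star> v) = \<epsilon> \<cdot> ((b \<star> I) \<cdot> (u \<boxtimes> v))"
    using times_cmp[OF bh I_hom u v] cmp_idm_left[OF v] by simp
  also have "\<dots> = (\<epsilon> \<cdot> (b \<star> I)) \<cdot> (u \<boxtimes> v)"
    using cmp_assoc[OF tarr_hom[OF u v] times_hom[OF bh I_hom] counit_hom] by simp
  also have "\<dots> = \<epsilon> \<cdot> ((I \<star> b) \<cdot> (u \<boxtimes> v))"
    using cmp_assoc[OF tarr_hom[OF u v] times_hom[OF I_hom bh] counit_hom] sym by simp
  also have "\<dots> = \<epsilon> \<cdot> (u \<star> (b \<cdot> v))"
    using times_cmp[OF I_hom bh u v] cmp_idm_left[OF u] by simp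
  finally show ?thesis .
qed

text \<open>The idempotent is a bimodule map over its image, like the conditional expectation onto a
  subalgebra.  This follows by moving \<open>b\<close> across the pairing until only products of elements of the image
  are left, which \<open>b\<close> fixes.\<close>
lemma expectation:
  assumes b: "subalgebra_idempotent b"
  shows "b \<cdot> (I \<star> b) = b \<star> b" "b \<cdot> (b \<star> I) = b \<star> b"
proof -
  have bh: "b \<in> hom C X X" and bb: "b \<cdot> b = b" and closed: "b \<cdot> (b \<star> b) = b \<star> b"
    using b by (auto simp: subalgebra_idempotent_def)
  have bI: "b \<cdot> I = b" by (rule cmp_idm_right[OF bh])
  note adj = pairing_adjoint[OF b]
  have Ib: "I \<star> b \<in> hom C (X \<boxtimes>\<^sub>o X) X" and bI': "b \<star> I \<in> hom C (X \<boxtimes>\<^sub>o X) X"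
    and bxb: "b \<star> b \<in> hom C (X \<boxtimes>\<^sub>o X) X"
    by (intro times_hom I_hom bh)+
  show "b \<cdot> (I \<star> b) = b \<star> b"
  proof (rule eq_via_pairing_right[OF cmp_hom[OF Ib bh] bxb])
    have "\<epsilon> \<cdot> ((b \<cdot> (I \<star> b)) \<star> I) = \<epsilon> \<cdot> (I \<star> (b \<star> b))"
      using adj[OF Ib I_hom] times_assoc[OF I_hom bh bh] bI by simp
    also have "\<dots> = \<epsilon> \<cdot> ((b \<cdot> (b \<star> b)) \<star> I)"
      using adj[OF I_hom bxb] adj[OF bxb I_hom] closed times_assoc[OF bh bh bh] bI by simp
    finally show "\<epsilon> \<cdot> ((b \<cdot> (I \<star> b)) \<star> I) = \<epsilon> \<cdot> ((b \<star> b) \<star> I)" by (simp add: closed)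
  qed
  show "b \<cdot> (b \<star> I) = b \<star> b"
  proof (rule eq_via_pairing_left[OF cmp_hom[OF bI' bh] bxb])
    have "\<epsilon> \<cdot> (I \<star> (b \<cdot> (b \<star> I))) = \<epsilon> \<cdot> ((b \<star> b) \<star> I)"
      using adj[OF I_hom bI'] times_assoc[OF bh bh I_hom] bI by simp
    also have "\<dots> = \<epsilon> \<cdot> (I \<star> (b \<cdot> (b \<star> b)))"
      using adj[OF bxb I_hom] adj[OF I_hom bxb] closed times_assoc[OF bh bh bh] bI by simp
    finally show "\<epsilon> \<cdot> (I \<star> (b \<cdot> (b \<star> I))) = \<epsilon> \<cdot> (I \<star> (b \<star> b))" by (simp add: closed)
  qed
qed

text \<open>The hypotheses say that each image contains the other; selfadjointness makes the kernels agree
  as well.\<close>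
lemma subalgebra_idempotent_antisym:
  assumes a: "subalgebra_idempotent a" and b: "subalgebra_idempotent b"
    and ba: "b \<cdot> a = a" and ab: "a \<cdot> b = b"
  shows "a = b"
proof -
  have ah: "a \<in> hom C X X" and bh: "b \<in> hom C X X"
    using a b by (auto simp: subalgebra_idempotent_def)
  have aI: "a \<cdot> I = a" "b \<cdot> I = b" by (rule cmp_idm_right[OF ah], rule cmp_idm_right[OF bh])
  show ?thesis
  proof (rule eq_via_pairing_right[OF ah bh])
    have "\<epsilon> \<cdot> (a \<star> I) = \<epsilon> \<cdot> (a \<star> b)" using pairing_adjoint[OF b ah I_hom] ba aI by simp
    also have "\<dots> = \<epsilon> \<cdot> (I \<star> b)" using pairing_adjoint[OF a I_hom bh] ab aI by simp
    also have "\<dots> = \<epsilon> \<cdot> (b \<star> I)" using pairing_adjoint[OF b I_hom I_hom] aI by simp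
    finally show "\<epsilon> \<cdot> (a \<star> I) = \<epsilon> \<cdot> (b \<star> I)" .
  qed
qed

section \<open>The averaging identity\<close>

definition defect where "defect b u = padd C u (scal C (-1) (b \<cdot> u))"

lemma defect_hom: "b \<in> hom C X X \<Longrightarrow> u \<in> hom C Y X \<Longrightarrow> defect b u \<in> hom C Y X"
  unfolding defect_def by (intro padd_hom scal_hom cmp_hom)

lemma defect_split:
  assumes "b \<in> hom C X X" "u \<in> hom C Y X"
  shows "padd C (b \<cdot> u) (defect b u) = u"
  unfolding defect_def by (rule padd_cancel[OF cmp_hom[OF assms(2,1)] assms(2)])

lemma cmp_defect:
  assumes b: "b \<in> hom C X X" "b \<cdot> b = b" and u: "u \<in> hom C Y X"
  shows "b \<cdot> defect b u = zarr C Y X"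
proof -
  have bu: "b \<cdot> u \<in> hom C Y X" by (rule cmp_hom[OF u b(1)])
  have "b \<cdot> defect b u = padd C (b \<cdot> u) (scal C (-1) (b \<cdot> (b \<cdot> u)))"
    unfolding defect_def
    using cmp_padd[OF b(1) hom_obj(1)[OF u] u scal_hom[OF bu]] cmp_scal[OF b(1) hom_obj(1)[OF u] bu]
    by simp
  also have "b \<cdot> (b \<cdot> u) = b \<cdot> u" using cmp_assoc[OF u b(1) b(1)] b(2) by simp
  finally show ?thesis using padd_minus[OF bu] by simp
qed

text \<open>In \<open>(b u + d) (b v + d')\<close>, with \<open>d\<close> and \<open>d'\<close> the defects, the mixed terms are killed by \<open>b\<close>
  because \<open>b\<close> is a bimodule map and annihilates defects.  The error is quadratic in the defects.\<close>
lemma multiplicative_up_to_defect: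
  assumes b: "subalgebra_idempotent b" and u: "u \<in> hom C Y X" and v: "v \<in> hom C Z X"
  shows "b \<cdot> (u \<star> v) = padd C ((b \<cdot> u) \<star> (b \<cdot> v)) (b \<cdot> (defect b u \<star> defect b v))"
proof -
  have bh: "b \<in> hom C X X" and bb: "b \<cdot> b = b"
    using b by (auto simp: subalgebra_idempotent_def)
  have bu: "b \<cdot> u \<in> hom C Y X" and bv: "b \<cdot> v \<in> hom C Z X"
    and ku: "defect b u \<in> hom C Y X" and kv: "defect b v \<in> hom C Z X"
    by (rule cmp_hom[OF u bh], rule cmp_hom[OF v bh], rule defect_hom[OF bh u], rule defect_hom[OF bh v])
  have Y: "Y \<in> obj C" and Z: "Z \<in> obj C" by (rule hom_obj[OF u], rule hom_obj[OF v])
  have YZ: "Y \<boxtimes>\<^sub>o Z \<in> obj C" by (rule tobj_obj[OF Y Z])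
  have mod_left: "b \<cdot> ((b \<cdot> s) \<star> t) = (b \<cdot> s) \<star> (b \<cdot> t)"
    if s: "s \<in> hom C Y X" and t: "t \<in> hom C Z X" for s t
  proof -
    have "b \<cdot> ((b \<cdot> s) \<star> t) = b \<cdot> ((b \<star> I) \<cdot> (s \<boxtimes> t))"
      using times_cmp[OF bh I_hom s t] cmp_idm_left[OF t] by simp
    also have "\<dots> = (b \<star> b) \<cdot> (s \<boxtimes> t)"
      using cmp_assoc[OF tarr_hom[OF s t] times_hom[OF bh I_hom] bh] expectation(2)[OF b] by simp
    finally show ?thesis using times_cmp[OF bh bh s t] by simp
  qed
  have mod_right: "b \<cdot> (s \<star> (b \<cdot> t)) = (b \<cdot> s) \<star> (b \<cdot> t)"
    if s: "s \<in> hom C Y X" and t: "t \<in> hom C Z X" for s t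
  proof -
    have "b \<cdot> (s \<star> (b \<cdot> t)) = b \<cdot> ((I \<star> b) \<cdot> (s \<boxtimes> t))"
      using times_cmp[OF I_hom bh s t] cmp_idm_left[OF s] by simp
    also have "\<dots> = (b \<star> b) \<cdot> (s \<boxtimes> t)"
      using cmp_assoc[OF tarr_hom[OF s t] times_hom[OF I_hom bh] bh] expectation(1)[OF b] by simp
    finally show ?thesis using times_cmp[OF bh bh s t] by simp
  qed
  have "u \<star> v = padd C ((b \<cdot> u) \<star> v) (defect b u \<star> v)"
    using padd_times[OF v Y bu ku] defect_split[OF bh u] by simp
  then have "b \<cdot> (u \<star> v) = padd C ((b \<cdot> u) \<star> (b \<cdot> v)) (b \<cdot> (defect b u \<star> v))"
    using cmp_padd[OF bh YZ times_hom[OF bu v] times_hom[OF ku v]] mod_left[OF u v] by simp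
  moreover have "b \<cdot> (defect b u \<star> v) = b \<cdot> (defect b u \<star> defect b v)"
  proof -
    have "defect b u \<star> v = padd C (defect b u \<star> defect b v) (defect b u \<star> (b \<cdot> v))"
    proof -
      have "padd C (defect b v) (b \<cdot> v) = v"
      proof -
        interpret vectorspace class_ring "hom_space C Z X" by (rule hom_vectorspace[OF Z X_obj])
        show ?thesis using M.a_comm[of "defect b v" "b \<cdot> v"] bv kv defect_split[OF bh v] by simp
      qed
      then show ?thesis using times_padd[OF ku Z kv bv] by simp
    qed
    moreover have "b \<cdot> (defect b u \<star> (b \<cdot> v)) = zarr C (Y \<boxtimes>\<^sub>o Z) X"
      using mod_right[OF ku v] cmp_defect[OF bh bb u] zarr_times[OF bv Y Y X_obj] by simp
    ultimately show ?thesis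
      using cmp_padd[OF bh YZ times_hom[OF ku kv] times_hom[OF ku bv]]
        padd_zarr[OF cmp_hom[OF times_hom[OF ku kv] bh]] by simp
  qed
  ultimately show ?thesis by simp
qed

text \<open>In elements: \<open>x \<mapsto> \<Sum> f(x g(x\<^sub>i)) h(x\<^sup>i)\<close>.\<close>
definition correction where
  "correction f g h = ((f \<cdot> (I \<star> g)) \<star> h) \<cdot> (I \<boxtimes> copair)"

lemma correction_hom:
  assumes "f \<in> hom C X X" "g \<in> hom C X X" "h \<in> hom C X X"
  shows "correction f g h \<in> hom C X X"
proof -
  have "(f \<cdot> (I \<star> g)) \<star> h \<in> hom C (X \<boxtimes>\<^sub>o (X \<boxtimes>\<^sub>o X)) X"
    using times_hom[OF cmp_hom[OF times_hom[OF I_hom assms(2)] assms(1)] assms(3)]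
      tobj_assoc[OF X_obj X_obj X_obj] by simp
  then show ?thesis unfolding correction_def by (rule cmp_hom[OF copair_right_hom])
qed

text \<open>Both sides come from \<open>T(x) = \<Sum> b(a x \<cdot> a x\<^sub>i) a x\<^sup>i\<close>.  Splitting off the quadratic error of \<open>b\<close> and
  averaging what remains gives \<open>T = l b a + R (a - b a)\<close>, where \<open>R\<close> is the correction.  Since \<open>a\<close> is
  a bimodule map, its copairing is central over its image, so the factor \<open>a x\<close> can also be moved to
  the far right, which gives \<open>T = l a\<close>.\<close>
lemma averaging_identity:
  assumes a: "subalgebra_idempotent a" and b: "subalgebra_idempotent b"
    and l: "((b \<cdot> a) \<star> a) \<cdot> copair = scal C l e"
  shows "correction b (defect b a) a \<cdot> defect b a = scal C l (defect b a)"
proof -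
  have ah: "a \<in> hom C X X" and aa: "a \<cdot> a = a" and bh: "b \<in> hom C X X"
    using a b by (auto simp: subalgebra_idempotent_def)
  define k where "k = defect b a"
  have ba: "b \<cdot> a \<in> hom C X X" by (rule cmp_hom[OF ah bh])
  have kh: "k \<in> hom C X X" unfolding k_def by (rule defect_hom[OF bh ah])
  have xa: "a \<star> a \<in> hom C (X \<boxtimes>\<^sub>o X) X" by (rule times_hom[OF ah ah])
  have baa: "(b \<cdot> a) \<star> a \<in> hom C (X \<boxtimes>\<^sub>o X) X" by (rule times_hom[OF ba ah])
  have bb': "(b \<cdot> a) \<star> (b \<cdot> a) \<in> hom C (X \<boxtimes>\<^sub>o X) X" by (rule times_hom[OF ba ba])
  have kk: "b \<cdot> (k \<star> k) \<in> hom C (X \<boxtimes>\<^sub>o X) X" by (rule cmp_hom[OF times_hom[OF kh kh] bh])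
  define T where "T = ((b \<cdot> (a \<star> a)) \<star> a) \<cdot> (I \<boxtimes> copair)"
  have one: "T = padd C (scal C l (b \<cdot> a)) (correction b k a \<cdot> k)"
  proof -
    have h1: "((b \<cdot> a) \<star> (b \<cdot> a)) \<star> a \<in> hom C (X \<boxtimes>\<^sub>o (X \<boxtimes>\<^sub>o X)) X"
      and h2: "(b \<cdot> (k \<star> k)) \<star> a \<in> hom C (X \<boxtimes>\<^sub>o (X \<boxtimes>\<^sub>o X)) X"
      using times_hom[OF bb' ah] times_hom[OF kk ah] tobj_assoc[OF X_obj X_obj X_obj] by auto
    have "(b \<cdot> (a \<star> a)) \<star> a
        = padd C (((b \<cdot> a) \<star> (b \<cdot> a)) \<star> a) ((b \<cdot> (k \<star> k)) \<star> a)"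
      using multiplicative_up_to_defect[OF b ah ah] padd_times[OF ah XX_obj bb' kk]
      by (simp add: k_def)
    then have "T = padd C ((((b \<cdot> a) \<star> (b \<cdot> a)) \<star> a) \<cdot> (I \<boxtimes> copair))
        (((b \<cdot> (k \<star> k)) \<star> a) \<cdot> (I \<boxtimes> copair))"
      unfolding T_def using padd_cmp[OF copair_right_hom X_obj h1 h2] by simp
    also have "(((b \<cdot> a) \<star> (b \<cdot> a)) \<star> a) \<cdot> (I \<boxtimes> copair) = scal C l (b \<cdot> a)"
      using times_assoc[OF ba ba ah] times_copair_right[OF ba baa] l
        times_scal[OF ba unt_obj unit_hom] unit_times(2)[OF ba] by simp
    also have "((b \<cdot> (k \<star> k)) \<star> a) \<cdot> (I \<boxtimes> copair) = correction b k a \<cdot> k"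
    proof -
      have Ik: "I \<star> k \<in> hom C (X \<boxtimes>\<^sub>o X) X" by (rule times_hom[OF I_hom kh])
      have "b \<cdot> (k \<star> k) = (b \<cdot> (I \<star> k)) \<cdot> (k \<boxtimes> I)"
        using times_cmp[OF I_hom kh kh I_hom] cmp_idm_left[OF kh] cmp_idm_right[OF kh]
          cmp_assoc[OF tarr_hom[OF kh I_hom] Ik bh] by simp
      then show ?thesis
        unfolding correction_def
        using times_copair_slide[OF cmp_hom[OF Ik bh] ah kh] by simp
    qed
    finally show ?thesis .
  qed
  have two: "T = scal C l a"
  proof -
    have am: "a \<cdot> \<mu> \<in> hom C (X \<boxtimes>\<^sub>o X) X" by (rule cmp_hom[OF mul_arr ah])
    have bam: "(b \<cdot> a) \<cdot> \<mu> \<in> hom C (X \<boxtimes>\<^sub>o X) X" by (rule cmp_hom[OF mul_arr ba])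
    have Ia: "I \<boxtimes> a \<in> hom C (X \<boxtimes>\<^sub>o X) (X \<boxtimes>\<^sub>o X)" and aI: "a \<boxtimes> I \<in> hom C (X \<boxtimes>\<^sub>o X) (X \<boxtimes>\<^sub>o X)"
      by (intro tarr_hom I_hom ah)+
    have "b \<cdot> (a \<star> a) = (b \<cdot> a) \<cdot> (a \<star> I)"
      using expectation(2)[OF a] cmp_assoc[OF times_hom[OF ah I_hom] ah bh] by simp
    also have "\<dots> = ((b \<cdot> a) \<cdot> \<mu>) \<cdot> (a \<boxtimes> I)"
      using cmp_assoc[OF aI mul_arr ba] by (simp add: times_def)
    finally have "T = ((((b \<cdot> a) \<cdot> \<mu>) \<star> a) \<cdot> (I \<boxtimes> copair)) \<cdot> a"
      unfolding T_def using times_copair_slide[OF bam ah ah] by simp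
    also have "\<dots> = (((b \<cdot> a) \<star> (a \<cdot> \<mu>)) \<cdot> (copair \<boxtimes> I)) \<cdot> a"
      using times_comul_right[OF ba ah] times_comul_left[OF ba ah] by simp
    also have "\<dots> = ((b \<cdot> a) \<star> (a \<cdot> \<mu>)) \<cdot> ((idm C (X \<boxtimes>\<^sub>o X) \<boxtimes> a) \<cdot> (copair \<boxtimes> I))"
      using cmp_assoc[OF ah copair_left_hom times_hom[OF ba am]] tarr_state_left[OF ah copair_hom]
      by simp
    also have "idm C (X \<boxtimes>\<^sub>o X) \<boxtimes> a = I \<boxtimes> (I \<boxtimes> a)"
      using tarr_assoc[OF hom_arr[OF I_hom] hom_arr[OF I_hom] hom_arr[OF ah]] tarr_idm[OF X_obj X_obj]
      by simp
    also have "((b \<cdot> a) \<star> (a \<cdot> \<mu>)) \<cdot> ((I \<boxtimes> (I \<boxtimes> a)) \<cdot> (copair \<boxtimes> I))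
        = (((b \<cdot> a) \<star> (a \<cdot> \<mu>)) \<cdot> (I \<boxtimes> (I \<boxtimes> a))) \<cdot> (copair \<boxtimes> I)"
      using cmp_assoc[OF copair_left_hom tarr_hom[OF I_hom Ia] times_hom[OF ba am]] by simp
    also have "((b \<cdot> a) \<star> (a \<cdot> \<mu>)) \<cdot> (I \<boxtimes> (I \<boxtimes> a)) = (b \<cdot> a) \<star> (a \<star> a)"
      using times_cmp[OF ba am I_hom Ia] cmp_idm_right[OF ba] cmp_assoc[OF Ia mul_arr ah]
        expectation(1)[OF a] by (simp add: times_def)
    also have "\<dots> = ((b \<cdot> a) \<star> a) \<star> a" by (rule times_assoc[OF ba ah ah, symmetric])
    also have "\<dots> \<cdot> (copair \<boxtimes> I) = scal C l a"
      using times_copair_left[OF ah baa] l scal_times[OF ah unt_obj unit_hom] unit_times(1)[OF ah]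
      by simp
    finally show ?thesis .
  qed
  have ch: "correction b k a \<cdot> k \<in> hom C X X"
    by (intro cmp_hom[OF kh] correction_hom bh kh ah)
  have lba: "scal C l (b \<cdot> a) \<in> hom C X X" and lk: "scal C l k \<in> hom C X X"
    by (rule scal_hom[OF ba], rule scal_hom[OF kh])
  have "padd C (scal C l (b \<cdot> a)) (correction b k a \<cdot> k) = scal C l a"
    using one two by simp
  also have "\<dots> = padd C (scal C l (b \<cdot> a)) (scal C l k)"
    using scal_padd[OF ba kh, of l] defect_split[OF bh ah] by (simp add: k_def)
  finally have eq: "padd C (scal C l (b \<cdot> a)) (correction b k a \<cdot> k)
      = padd C (scal C l (b \<cdot> a)) (scal C l k)" .
  have "correction b k a \<cdot> k = scal C l k"
    by (rule trans[OF sym[OF padd_cancel'[OF lba ch]] padd_cancel'[OF lba lk, folded eq]])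
  then show ?thesis by (simp add: k_def)
qed

section \<open>Finitely many subalgebra idempotents\<close>

lemma times_bilinear_maps:
  assumes "g \<in> hom C X X"
  shows "(\<lambda>f. f \<star> g) \<in> linear_maps (hom_space C X X) (hom_space C (X \<boxtimes>\<^sub>o X) X)"
    "(\<lambda>f. g \<star> f) \<in> linear_maps (hom_space C X X) (hom_space C (X \<boxtimes>\<^sub>o X) X)"
  using times_left_maps[OF assms X_obj] times_right_maps[OF assms X_obj] by auto

text \<open>Left multiplication by the state \<open>\<Sum> f(x\<^sub>i) g(x\<^sup>i)\<close>.  This represents the scalar \<open>l\<close> of the averaging
  identity as an endomorphism that is manifestly bilinear in \<open>f\<close> and \<open>g\<close>.\<close>
definition average where
  "average f g = ((f \<star> g) \<cdot> copair) \<star> I"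

lemma average_bilinear: "bilinear_op (hom_space C X X) average"
proof -
  have post: "(\<lambda>t. (t \<cdot> copair) \<star> I) \<in> linear_maps (hom_space C (X \<boxtimes>\<^sub>o X) X) (hom_space C X X)"
    using linear_maps_compose[OF cmp_left_maps[OF copair_hom X_obj] times_left_maps[OF I_hom unt_obj]]
    by (simp add: tobj_unt_left[OF X_obj])
  show ?thesis
    unfolding bilinear_op_def average_def
    using linear_maps_compose[OF times_bilinear_maps(1) post]
      linear_maps_compose[OF times_bilinear_maps(2) post] by auto
qed

lemma correction_linear:
  assumes f: "f \<in> hom C X X" and g: "g \<in> hom C X X" and h: "h \<in> hom C X X"
  shows "(\<lambda>f. correction f g h) \<in> linear_maps (hom_space C X X) (hom_space C X X)"
    "(\<lambda>g. correction f g h) \<in> linear_maps (hom_space C X X) (hom_space C X X)"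
    "(\<lambda>h. correction f g h) \<in> linear_maps (hom_space C X X) (hom_space C X X)"
proof -
  have Ig: "I \<star> g \<in> hom C (X \<boxtimes>\<^sub>o X) X" by (rule times_hom[OF I_hom g])
  have insert: "(\<lambda>t. t \<cdot> (I \<boxtimes> copair))
      \<in> linear_maps (hom_space C ((X \<boxtimes>\<^sub>o X) \<boxtimes>\<^sub>o X) X) (hom_space C X X)"
    using cmp_left_maps[OF copair_right_hom X_obj] tobj_assoc[OF X_obj X_obj X_obj] by simp
  note post = linear_maps_compose[OF times_left_maps[OF h XX_obj] insert]
  show "(\<lambda>f. correction f g h) \<in> linear_maps (hom_space C X X) (hom_space C X X)"
    unfolding correction_def by (rule linear_maps_compose[OF cmp_left_maps[OF Ig X_obj] post])
  show "(\<lambda>g. correction f g h) \<in> linear_maps (hom_space C X X) (hom_space C X X)"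
    unfolding correction_def
    by (rule linear_maps_compose[OF linear_maps_compose[OF times_bilinear_maps(2)[OF I_hom]
          cmp_right_maps[OF f XX_obj]] post])
  show "(\<lambda>h. correction f g h) \<in> linear_maps (hom_space C X X) (hom_space C X X)"
    unfolding correction_def
    by (rule linear_maps_compose[OF times_right_maps[OF cmp_hom[OF Ig f] X_obj] insert])
qed

text \<open>The element \<open>l - R\<close> of the averaging identity.\<close>
definition obstruction where
  "obstruction b a = padd C (average (b \<cdot> a) a) (scal C (-1) (correction b (defect b a) a))"

lemma obstruction_annihilates:
  assumes a: "subalgebra_idempotent a" and b: "subalgebra_idempotent b"
    and l: "((b \<cdot> a) \<star> a) \<cdot> copair = scal C l e"
  shows "obstruction b a \<cdot> defect b a = zarr C X X"
proof -
  have ah: "a \<in> hom C X X" and bh: "b \<in> hom C X X"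
    using a b by (auto simp: subalgebra_idempotent_def)
  have kh: "defect b a \<in> hom C X X" by (rule defect_hom[OF bh ah])
  have ch: "correction b (defect b a) a \<in> hom C X X" by (rule correction_hom[OF bh kh ah])
  have av: "average (b \<cdot> a) a = scal C l I"
    unfolding average_def using l scal_times[OF I_hom unt_obj unit_hom] unit_times(1)[OF I_hom] by simp
  have "obstruction b a \<cdot> defect b a
      = padd C (scal C l I \<cdot> defect b a) (scal C (-1) (correction b (defect b a) a) \<cdot> defect b a)"
    unfolding obstruction_def av by (rule padd_cmp[OF kh X_obj scal_hom[OF I_hom] scal_hom[OF ch]])
  also have "\<dots> = padd C (scal C l (defect b a)) (scal C (-1) (scal C l (defect b a)))"
    using scal_cmp[OF kh X_obj I_hom] scal_cmp[OF kh X_obj ch] cmp_idm_left[OF kh]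
      averaging_identity[OF a b l] by simp
  also have "\<dots> = zarr C X X" by (rule padd_minus[OF scal_hom[OF kh]])
  finally show ?thesis .
qed

lemma obstruction_diagonal:
  assumes a: "subalgebra_idempotent a" and l: "(a \<star> a) \<cdot> copair = scal C l e"
  shows "obstruction a a = scal C l I"
proof -
  have ah: "a \<in> hom C X X" and aa: "a \<cdot> a = a"
    using a by (auto simp: subalgebra_idempotent_def)
  have "defect a a = zarr C X X" unfolding defect_def aa by (rule padd_minus[OF ah])
  then have "correction a (defect a a) a = zarr C X X"
    using linear_maps_zarr[OF correction_linear(2)[OF ah I_hom ah] X_obj X_obj] by simp
  moreover have "average a a = scal C l I"
    unfolding average_def using l scal_times[OF I_hom unt_obj unit_hom] unit_times(1)[OF I_hom] by simp
  moreover have "scal C (-1) (zarr C X X) = zarr C X X"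
    using linear_maps_zarr[OF scal_maps[OF X_obj X_obj] X_obj X_obj] .
  ultimately show ?thesis
    unfolding obstruction_def aa using padd_zarr[OF scal_hom[OF I_hom]] by simp
qed

lemma obstruction_finite_rank:
  assumes fd: "vectorspace.fin_dim class_ring (hom_space C X X)"
    and p: "\<And>x. p x \<in> hom C X X"
  shows "finite_rank_family (hom_space C X X) (\<lambda>x y. obstruction (p y) (p x))"
proof -
  let ?V = "hom_space C X X"
  have V: "vectorspace class_ring ?V" by (rule hom_vectorspace[OF X_obj X_obj])
  have a: "finite_rank_family ?V (\<lambda>x y. p x)" by (rule finite_rank_family_first) (simp add: p)
  have b: "finite_rank_family ?V (\<lambda>x y. p y)" by (rule finite_rank_family_second) (simp add: p)
  have ba: "finite_rank_family ?V (\<lambda>x y. p y \<cdot> p x)"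
    by (rule finite_rank_family_op[OF V fd cmp_bilinear[OF X_obj] b a])
  have neg: "scal C (-1) \<in> linear_maps ?V ?V" by (rule scal_maps[OF X_obj X_obj])
  have k: "finite_rank_family ?V (\<lambda>x y. defect (p y) (p x))"
    using finite_rank_family_add[OF V a finite_rank_family_hom[OF neg ba]] by (simp add: defect_def)
  have kh: "defect (p y) (p x) \<in> hom C X X" for x y by (rule defect_hom[OF p p])
  have "finite_rank_family ?V (\<lambda>x y. correction (p y) (defect (p y) (p x)) (p x))"
  proof (rule finite_rank_family_bilinear[OF V fd b,
      where B = "\<lambda>f x y. correction f (defect (p y) (p x)) (p x)"])
    fix f assume "f \<in> carrier ?V"
    then have f: "f \<in> hom C X X" by simp
    have "bilinear_op ?V (correction f)"
      unfolding bilinear_op_def using correction_linear(2,3)[OF f] by auto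
    then show "finite_rank_family ?V (\<lambda>x y. correction f (defect (p y) (p x)) (p x))"
      by (rule finite_rank_family_op[OF V fd _ k a])
  next
    show "(\<lambda>f. correction f (defect (p y) (p x)) (p x)) \<in> linear_maps ?V ?V" for x y
      by (rule correction_linear(1)[OF I_hom kh p])
  qed
  from finite_rank_family_add[OF V finite_rank_family_op[OF V fd average_bilinear ba a]
      finite_rank_family_hom[OF neg this]]
  show ?thesis by (simp add: obstruction_def)
qed

text \<open>A nonzero defect of \<open>a\<close> against \<open>b\<close> makes the obstruction a left zero divisor in \<open>End(X)\<close>, and two
  distinct idempotents have a nonzero defect in at least one direction.\<close>
theorem finite_subalgebra_idempotents:
  assumes fd: "vectorspace.fin_dim class_ring (hom_space C X X)"
    and states: "\<And>w. w \<in> hom C (unt C) X \<Longrightarrow> \<exists>c. w = scal C c e"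
    and P: "\<And>b. b \<in> P \<Longrightarrow> subalgebra_idempotent b"
    and nz: "\<And>b. b \<in> P \<Longrightarrow> (b \<star> b) \<cdot> copair \<noteq> zarr C (unt C) X"
  shows "finite P"
proof -
  let ?V = "hom_space C X X"
  have V: "vectorspace class_ring ?V" by (rule hom_vectorspace[OF X_obj X_obj])
  have Ph: "b \<in> hom C X X" if "b \<in> P" for b
    using P[OF that] by (simp add: subalgebra_idempotent_def)
  \<comment> \<open>Families of finite rank are indexed by a whole type, so that points outside \<open>P\<close> need a value.\<close>
  define p where "p b = (if b \<in> P then b else I)" for b
  have ph: "p b \<in> hom C X X" for b using Ph I_hom by (simp add: p_def)
  have "\<exists>c. (b \<star> b) \<cdot> copair = scal C c e" if "b \<in> P" for b
    by (intro states cmp_hom[OF copair_hom] times_hom Ph that)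
  then obtain c where c: "\<And>b. b \<in> P \<Longrightarrow> (b \<star> b) \<cdot> copair = scal C (c b) e" by metis
  show ?thesis
  proof (rule finite_if_singular_family[OF V fd cmp_bilinear[OF X_obj] obstruction_finite_rank[OF fd ph]])
    show "obstruction (p b) (p b) \<cdot> v = c b \<odot>\<^bsub>?V\<^esub> v" if "b \<in> P" "v \<in> carrier ?V" for b v
      using that obstruction_diagonal[OF P c] scal_cmp[OF _ X_obj I_hom, of v X] cmp_idm_left[of v X X]
      by (simp add: p_def)
    show "c b \<noteq> 0" if "b \<in> P" for b
      using nz[OF that] c[OF that] scal_zero[OF unit_hom] by auto
    fix a b assume ab: "a \<in> P" "b \<in> P" "a \<noteq> b"
    have kill: "obstruction v u \<cdot> defect v u = zarr C X X" if "u \<in> P" "v \<in> P" for u v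
    proof -
      have "((v \<cdot> u) \<star> u) \<cdot> copair \<in> hom C (unt C) X"
        by (intro cmp_hom[OF copair_hom] times_hom cmp_hom[OF Ph[OF that(1)] Ph[OF that(2)]] Ph that)
      then obtain l where "((v \<cdot> u) \<star> u) \<cdot> copair = scal C l e" using states by blast
      then show ?thesis by (rule obstruction_annihilates[OF P[OF that(1)] P[OF that(2)]])
    qed
    have contained: "v \<cdot> u = u" if "u \<in> P" "v \<in> P" "defect v u = zarr C X X" for u v
      using defect_split[OF Ph[OF that(2)] Ph[OF that(1)]] that(3)
        padd_zarr[OF cmp_hom[OF Ph[OF that(1)] Ph[OF that(2)]]] by simp
    have "defect b a \<noteq> zarr C X X \<or> defect a b \<noteq> zarr C X X"
      using subalgebra_idempotent_antisym[OF P[OF ab(1)] P[OF ab(2)]] contained ab by blast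
    then show "\<exists>v\<in>carrier ?V. v \<noteq> \<zero>\<^bsub>?V\<^esub> \<and>
        (obstruction (p b) (p a) \<cdot> v = \<zero>\<^bsub>?V\<^esub> \<or> obstruction (p a) (p b) \<cdot> v = \<zero>\<^bsub>?V\<^esub>)"
      using kill[OF ab(1,2)] kill[OF ab(2,1)] defect_hom[OF Ph Ph] ab by (auto simp: p_def)
  qed
qed

section \<open>Consequences of weak positivity\<close>

text \<open>The arrow \<open>x \<mapsto> \<Sum> f(x x\<^sub>i) x\<^sup>i\<close> is left multiplication by the average of \<open>f\<close>, because the
  copairing is central.  As \<open>f\<close> is multiplicative, it is also \<open>x \<mapsto> f(x) \<Sum> f(x\<^sub>i) x\<^sup>i\<close>.\<close>
lemma automorphism_trivial:
  assumes f: "f \<in> hom C X X" and mult: "\<mu> \<cdot> (f \<boxtimes> f) = f \<cdot> \<mu>"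
    and l: "(f \<star> I) \<cdot> copair = scal C l e" "l \<noteq> 0"
  shows "f = I"
proof -
  have fI: "f \<star> I \<in> hom C (X \<boxtimes>\<^sub>o X) X" by (rule times_hom[OF f I_hom])
  have "(f \<star> I) \<cdot> \<delta> = scal C l I"
  proof -
    have "(f \<star> I) \<cdot> \<delta> = (f \<star> (I \<star> I)) \<cdot> (copair \<boxtimes> I)"
      using times_comul_left[OF f I_hom] cmp_idm_left[OF mul_arr] I_times_I by simp
    also have "\<dots> = ((f \<star> I) \<cdot> copair) \<star> I"
      using times_assoc[OF f I_hom I_hom] times_copair_left[OF I_hom fI] by simp
    finally show ?thesis
      using l scal_times[OF I_hom unt_obj unit_hom] unit_times(1)[OF I_hom] by simp
  qed
  moreover have "(f \<star> I) \<cdot> \<delta> = scal C l f"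
  proof -
    have "(f \<star> I) \<cdot> \<delta> = ((f \<star> f) \<star> I) \<cdot> (I \<boxtimes> copair)"
      using times_comul_right[OF f I_hom] mult by (simp add: times_def)
    also have "\<dots> = f \<star> ((f \<star> I) \<cdot> copair)"
      using times_assoc[OF f f I_hom] times_copair_right[OF f fI] by simp
    finally show ?thesis
      using l times_scal[OF f unt_obj unit_hom] unit_times(2)[OF f] by simp
  qed
  ultimately have "scal C (1 / l) (scal C l f) = scal C (1 / l) (scal C l I)" by simp
  then show ?thesis
    using scal_scal[OF f] scal_scal[OF I_hom] scal_one[OF f] scal_one[OF I_hom] l(2) by simp
qed

lemma connected_states:
  assumes "connected_algebra C F"
  shows "e \<noteq> zarr C (unt C) X" "w \<in> hom C (unt C) X \<Longrightarrow> \<exists>c. w = scal C c e"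
proof -
  let ?V = "hom_space C (unt C) X"
  interpret vectorspace class_ring ?V by (rule hom_vectorspace[OF unt_obj X_obj])
  have fd: "fin_dim" and d: "dim = 1" using assms by (auto simp: connected_algebra_def)
  obtain B where B: "finite B" "basis B" using finite_basis_exists[OF fd] by blast
  then have "card B = 1" using dim_basis d by simp
  then obtain v where Bv: "B = {v}" by (auto simp: card_1_singleton_iff)
  have v: "v \<in> hom C (unt C) X" and gen: "span {v} = hom C (unt C) X" and li: "lin_indpt {v}"
    using B(2) Bv by (auto simp: basis_def)
  have v0: "v \<noteq> zarr C (unt C) X"
  proof
    assume "v = zarr C (unt C) X"
    moreover have "(UNIV :: complex set) \<noteq> {0}" by (metis UNIV_I singletonD zero_neq_one)
    ultimately show False using zero_lin_dep[of "{v}"] li by simp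
  qed
  have sp: "\<exists>c. w = scal C c v" if w: "w \<in> hom C (unt C) X" for w
  proof -
    have "w \<in> span {v}" using gen w by simp
    then obtain a where "w = lincomb a {v}" using finite_span[of "{v}"] v by auto
    then show ?thesis using v scal_hom[OF v] padd_zarr[OF scal_hom[OF v]] by (auto simp: lincomb_def)
  qed
  show e0: "e \<noteq> zarr C (unt C) X"
  proof
    assume "e = zarr C (unt C) X"
    then have "e \<star> v = zarr C (unt C) X"
      using zarr_times[OF v unt_obj unt_obj X_obj] tobj_unt_left[OF unt_obj] by simp
    then show False using unit_times(1)[OF v] v0 by simp
  qed
  obtain c where c: "e = scal C c v" using sp[OF unit_hom] by blast
  then have "c \<noteq> 0" using e0 scal_zero[OF v] by auto
  then have "v = scal C (1 / c) e" using c scal_scal[OF v] scal_one[OF v] by simp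
  then show "\<exists>c. w = scal C c e" if "w \<in> hom C (unt C) X"
    using sp[OF that] scal_scal[OF unit_hom] by metis
qed

lemma tr_eq:
  assumes "D X = frob_dual C F" "f \<in> hom C X X"
  shows "tr C D X f = \<epsilon> \<cdot> ((f \<star> I) \<cdot> copair)"
proof -
  have fI: "f \<boxtimes> I \<in> hom C (X \<boxtimes>\<^sub>o X) (X \<boxtimes>\<^sub>o X)" by (rule tarr_hom[OF assms(2) I_hom])
  show ?thesis
    using assms(1) cmp_assoc[OF cmp_hom[OF copair_hom fI] mul_arr counit_hom]
      cmp_assoc[OF copair_hom fI mul_arr]
    by (simp add: tr_def frob_dual_def copair_def times_def)
qed

text \<open>Selfadjointness of \<open>i i\<^sup>*\<close> uses that \<open>i\<close> is the dual of \<open>i\<^sup>*\<close>: it moves the inclusion, and not only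
  its dual, across the pairings.\<close>
lemma frobenius_subalgebra_idempotent:
  assumes "frobenius_subalgebra C F S"
  shows "subalgebra_idempotent (sub_idem C F S)" "sub_idem C F S \<cdot> e = e"
proof -
  obtain A i where S: "S = (A, i)" by force
  define p where "p = frob_star C A F i"
  have A: "frobenius_algebra C A" and ih: "i \<in> hom C (fobj A) X"
    and mult: "\<mu> \<cdot> (i \<boxtimes> i) = i \<cdot> fmul A" and unital: "i \<cdot> funit A = e"
    and ip: "frob_star C F A p = i" and pi: "p \<cdot> i = idm C (fobj A)"
    using assms unfolding S frobenius_subalgebra_def unital_algebra_mono_def algebra_hom_def p_def
    by auto
  interpret A: frobenius_object C A by unfold_locales (rule A)
  note dA = A.frob_dual_is_left_dual
  have ph: "p \<in> hom C X (fobj A)"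
    using dual_arr_pairing(1)[OF dA frob_dual_is_left_dual ih]
    by (simp add: p_def frob_star_def frob_dual_def)
  have ev_p: "(fcounit A \<cdot> fmul A) \<cdot> (p \<boxtimes> A.I) = (\<epsilon> \<cdot> \<mu>) \<cdot> (I \<boxtimes> i)"
    using dual_arr_pairing(2)[OF dA frob_dual_is_left_dual ih]
    by (simp add: p_def frob_star_def frob_dual_def)
  have ev_i: "(\<epsilon> \<cdot> \<mu>) \<cdot> (i \<boxtimes> I) = (fcounit A \<cdot> fmul A) \<cdot> (A.I \<boxtimes> p)"
    using dual_arr_pairing(2)[OF frob_dual_is_left_dual dA ph] ip
    by (simp add: frob_star_def frob_dual_def)
  have b: "sub_idem C F S = i \<cdot> p" by (simp add: S sub_idem_def p_def)
  have bh: "i \<cdot> p \<in> hom C X X" by (rule cmp_hom[OF ph ih])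
  have ev: "\<epsilon> \<cdot> \<mu> \<in> hom C (X \<boxtimes>\<^sub>o X) (unt C)" by (rule cmp_hom[OF mul_arr counit_hom])
  have evA: "fcounit A \<cdot> fmul A \<in> hom C (fobj A \<boxtimes>\<^sub>o fobj A) (unt C)"
    by (rule cmp_hom[OF A.mul_arr A.counit_hom])
  have bb: "(i \<cdot> p) \<cdot> (i \<cdot> p) = i \<cdot> p"
    using cmp_assoc[OF bh ph ih] cmp_assoc[OF ph ih ph] pi cmp_idm_left[OF ph] by simp
  have "\<epsilon> \<cdot> ((i \<cdot> p) \<star> I) = \<epsilon> \<cdot> (I \<star> (i \<cdot> p))"
  proof -
    have "\<epsilon> \<cdot> ((i \<cdot> p) \<star> I) = (\<epsilon> \<cdot> \<mu>) \<cdot> ((i \<cdot> p) \<boxtimes> I)"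
      unfolding times_def using cmp_assoc[OF tarr_hom[OF bh I_hom] mul_arr counit_hom] by simp
    also have "(i \<cdot> p) \<boxtimes> I = (i \<boxtimes> I) \<cdot> (p \<boxtimes> I)"
      using interchange[OF ph ih I_hom I_hom] cmp_idm_left[OF I_hom] by simp
    also have "(\<epsilon> \<cdot> \<mu>) \<cdot> ((i \<boxtimes> I) \<cdot> (p \<boxtimes> I)) = (fcounit A \<cdot> fmul A) \<cdot> ((A.I \<boxtimes> p) \<cdot> (p \<boxtimes> I))"
      using cmp_assoc[OF tarr_hom[OF ph I_hom] tarr_hom[OF ih I_hom] ev] ev_i
        cmp_assoc[OF tarr_hom[OF ph I_hom] tarr_hom[OF A.I_hom ph] evA] by simp
    also have "(A.I \<boxtimes> p) \<cdot> (p \<boxtimes> I) = (p \<boxtimes> A.I) \<cdot> (I \<boxtimes> p)"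
      using tarr_split_left[OF ph ph] tarr_split_right[OF ph ph] by simp
    also have "(fcounit A \<cdot> fmul A) \<cdot> ((p \<boxtimes> A.I) \<cdot> (I \<boxtimes> p)) = (\<epsilon> \<cdot> \<mu>) \<cdot> ((I \<boxtimes> i) \<cdot> (I \<boxtimes> p))"
      using cmp_assoc[OF tarr_hom[OF I_hom ph] tarr_hom[OF ph A.I_hom] evA] ev_p
        cmp_assoc[OF tarr_hom[OF I_hom ph] tarr_hom[OF I_hom ih] ev] by simp
    also have "(I \<boxtimes> i) \<cdot> (I \<boxtimes> p) = I \<boxtimes> (i \<cdot> p)"
      using interchange[OF I_hom I_hom ph ih] cmp_idm_left[OF I_hom] by simp
    also have "(\<epsilon> \<cdot> \<mu>) \<cdot> (I \<boxtimes> (i \<cdot> p)) = \<epsilon> \<cdot> (I \<star> (i \<cdot> p))"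
      unfolding times_def using cmp_assoc[OF tarr_hom[OF I_hom bh] mul_arr counit_hom] by simp
    finally show ?thesis .
  qed
  moreover have "(i \<cdot> p) \<cdot> ((i \<cdot> p) \<star> (i \<cdot> p)) = (i \<cdot> p) \<star> (i \<cdot> p)"
  proof -
    have pp: "p \<boxtimes> p \<in> hom C (X \<boxtimes>\<^sub>o X) (fobj A \<boxtimes>\<^sub>o fobj A)" by (rule tarr_hom[OF ph ph])
    have mpp: "fmul A \<cdot> (p \<boxtimes> p) \<in> hom C (X \<boxtimes>\<^sub>o X) (fobj A)" by (rule cmp_hom[OF pp A.mul_arr])
    have "(i \<cdot> p) \<star> (i \<cdot> p) = \<mu> \<cdot> ((i \<boxtimes> i) \<cdot> (p \<boxtimes> p))"
      unfolding times_def using interchange[OF ph ih ph ih] by simp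
    also have "\<dots> = i \<cdot> (fmul A \<cdot> (p \<boxtimes> p))"
      using cmp_assoc[OF pp tarr_hom[OF ih ih] mul_arr] mult cmp_assoc[OF pp A.mul_arr ih] by simp
    finally have eq: "(i \<cdot> p) \<star> (i \<cdot> p) = i \<cdot> (fmul A \<cdot> (p \<boxtimes> p))" .
    have "(i \<cdot> p) \<cdot> (i \<cdot> (fmul A \<cdot> (p \<boxtimes> p))) = i \<cdot> ((p \<cdot> i) \<cdot> (fmul A \<cdot> (p \<boxtimes> p)))"
      using cmp_assoc[OF cmp_hom[OF mpp ih] ph ih] cmp_assoc[OF mpp ih ph] by simp
    then show ?thesis unfolding eq pi using cmp_idm_left[OF mpp] by simp
  qed
  ultimately show "subalgebra_idempotent (sub_idem C F S)"
    unfolding b subalgebra_idempotent_def using bh bb by simp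
  have "(i \<cdot> p) \<cdot> (i \<cdot> funit A) = i \<cdot> ((p \<cdot> i) \<cdot> funit A)"
    using cmp_assoc[OF cmp_hom[OF A.unit_hom ih] ph ih] cmp_assoc[OF A.unit_hom ih ph] by simp
  then show "sub_idem C F S \<cdot> e = e"
    unfolding b using unital pi cmp_idm_left[OF A.unit_hom] by simp
qed

text \<open>Fixing the unit keeps \<open>b\<close> nonzero, so that positivity applies to it.\<close>
lemma weakly_positive_nonzero:
  assumes D: "D X = frob_dual C F" and pos: "weakly_positive C D \<phi> X" and \<phi>: "\<phi> \<in> hom C X X"
    and e0: "e \<noteq> zarr C (unt C) X"
    and b: "b \<in> hom C X X" "b \<cdot> b = b" "b \<cdot> e = e"
  shows "\<epsilon> \<cdot> (((\<phi> \<cdot> b) \<star> I) \<cdot> copair) \<noteq> zarr C (unt C) (unt C)"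
proof
  assume zero: "\<epsilon> \<cdot> (((\<phi> \<cdot> b) \<star> I) \<cdot> copair) = zarr C (unt C) (unt C)"
  have "b \<noteq> zarr C X X"
    using b(3) e0 zarr_cmp[OF unit_hom X_obj X_obj X_obj] by auto
  then obtain r :: real where r: "r > 0"
    and tr: "tr C D X (\<phi> \<cdot> b) = scal C (complex_of_real r) (idm C (unt C))"
    using pos b unfolding weakly_positive_def by blast
  have i: "idm C (unt C) \<in> hom C (unt C) (unt C)" by (rule idm_hom[OF unt_obj])
  have "scal C (complex_of_real r) (idm C (unt C)) = zarr C (unt C) (unt C)"
    using tr tr_eq[where D = D, OF D cmp_hom[OF b(1) \<phi>]] zero by simp
  then have "scal C (complex_of_real r) e = zarr C (unt C) X"
    using cmp_scal[OF unit_hom unt_obj i, of "complex_of_real r"] cmp_idm_right[OF unit_hom]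
      cmp_zarr[OF unit_hom unt_obj unt_obj unt_obj] by simp
  then have "scal C (1 / complex_of_real r) (scal C (complex_of_real r) e)
      = scal C (1 / complex_of_real r) (zarr C (unt C) X)" by simp
  then show False
    using e0 r scal_scal[OF unit_hom] scal_one[OF unit_hom]
      linear_maps_zarr[OF scal_maps[OF unt_obj X_obj] unt_obj X_obj] by simp
qed

text \<open>Weak positivity enters twice: for the identity, to show that \<open>\<phi>\<close> is trivial, and then, with
  \<open>\<phi> = 1\<close>, for each idempotent \<open>b\<close>, whose trace \<open>\<epsilon> (b \<star> I) \<kappa>\<close> equals \<open>\<epsilon> (b \<star> b) \<kappa>\<close> by selfadjointness.\<close>
theorem finite_frobenius_subalgebra_idempotents:
  assumes connected: "connected_algebra C F"
    and D: "D X = frob_dual C F"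
    and pos: "weakly_positive C D \<phi> X"
    and \<phi>: "algebra_hom C F F \<phi>"
    and fd: "vectorspace.fin_dim class_ring (hom_space C X X)"
  shows "finite (sub_idem C F ` {S. frobenius_subalgebra C F S})"
proof -
  note states = connected_states[OF connected]
  have \<phi>h: "\<phi> \<in> hom C X X" and mult: "\<mu> \<cdot> (\<phi> \<boxtimes> \<phi>) = \<phi> \<cdot> \<mu>"
    using \<phi> by (auto simp: algebra_hom_def)
  have "\<phi> = I"
  proof -
    have "(\<phi> \<star> I) \<cdot> copair \<in> hom C (unt C) X"
      by (rule cmp_hom[OF copair_hom times_hom[OF \<phi>h I_hom]])
    then obtain l where l: "(\<phi> \<star> I) \<cdot> copair = scal C l e" using states(2) by blast
    have "(\<phi> \<star> I) \<cdot> copair \<noteq> zarr C (unt C) X"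
      using weakly_positive_nonzero[where D = D, OF D pos \<phi>h states(1) I_hom cmp_idm_left[OF I_hom]
          cmp_idm_left[OF unit_hom]] cmp_idm_right[OF \<phi>h]
        cmp_zarr[OF counit_hom unt_obj unt_obj X_obj] by auto
    then have "l \<noteq> 0" using l scal_zero[OF unit_hom] by auto
    then show ?thesis by (rule automorphism_trivial[OF \<phi>h mult l])
  qed
  show ?thesis
  proof (rule finite_subalgebra_idempotents[OF fd states(2)])
    fix b assume "b \<in> sub_idem C F ` {S. frobenius_subalgebra C F S}"
    then have b: "subalgebra_idempotent b" and be: "b \<cdot> e = e"
      using frobenius_subalgebra_idempotent by auto
    then show "subalgebra_idempotent b" by simp
    have bh: "b \<in> hom C X X" and bb: "b \<cdot> b = b" using b by (auto simp: subalgebra_idempotent_def)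
    have bI: "b \<star> I \<in> hom C (X \<boxtimes>\<^sub>o X) X" and bsb: "b \<star> b \<in> hom C (X \<boxtimes>\<^sub>o X) X"
      by (rule times_hom[OF bh I_hom], rule times_hom[OF bh bh])
    show "(b \<star> b) \<cdot> copair \<noteq> zarr C (unt C) X"
    proof
      assume "(b \<star> b) \<cdot> copair = zarr C (unt C) X"
      then have "\<epsilon> \<cdot> ((b \<star> b) \<cdot> copair) = zarr C (unt C) (unt C)"
        using cmp_zarr[OF counit_hom unt_obj unt_obj X_obj] by simp
      moreover have "\<epsilon> \<cdot> (b \<star> b) = \<epsilon> \<cdot> (b \<star> I)"
        using pairing_adjoint[OF b bh I_hom] bb cmp_idm_right[OF bh] by simp
      then have "\<epsilon> \<cdot> ((b \<star> b) \<cdot> copair) = \<epsilon> \<cdot> ((b \<star> I) \<cdot> copair)"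
        using cmp_assoc[OF copair_hom bsb counit_hom] cmp_assoc[OF copair_hom bI counit_hom] by simp
      ultimately show False
        using weakly_positive_nonzero[where D = D, OF D pos \<phi>h states(1) bh bb be] \<open>\<phi> = I\<close> cmp_idm_left[OF bh]
        by simp
    qed
  qed auto
qed

end

section \<open>Coherent sublattices\<close>

text \<open>A class of Frobenius subalgebras is determined by its idempotent.\<close>
theorem theorem9p6:
  fixes C :: "('o, 'a) lin_moncat"
    and D :: "'o \<Rightarrow> ('o, 'a) dual_datum"
    and \<phi> :: "'o \<Rightarrow> 'a"
    and X :: "('o, 'a) frob"
    and L :: "(('o, 'a) frob \<times> 'a) set set"
  assumes "abelian_rigid_monoidal_category C"
    and "linear_simple_unit C"
    and "quasi_pivotal C D \<phi>"
    and "frobenius_algebra C X"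
    and "D (fobj X) = frob_dual C X"
    and "finite_length C (fobj X)"
    and "connected_algebra C X"
    and "weakly_positive C D (\<phi> (fobj X)) (fobj X)"
    and "algebra_iso C X X (\<phi> (fobj X))"
    and "vectorspace.fin_dim class_ring (hom_space C (fobj X) (fobj X))"
    and "coherent_sublattice C X L"
  shows "finite L"
proof -
  interpret abelian_rigid_monoidal_category C by (rule assms(1))
  interpret frobenius_object C X by unfold_locales (rule assms(4))
  let ?S = "{S. frobenius_subalgebra C X S}"
  have "finite (sub_idem C X ` ?S)"
    using finite_frobenius_subalgebra_idempotents[where D = D, OF assms(7,5,8) _ assms(10)] assms(9)
    by (simp add: algebra_iso_def)
  moreover have "L \<subseteq> (\<lambda>b. {T \<in> ?S. sub_idem C X T = b}) ` (sub_idem C X ` ?S)"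
  proof
    fix a assume "a \<in> L"
    then have "a \<in> ?S // sub_equiv C X"
      using assms(11)
      by (auto simp: coherent_sublattice_def frob_sublattice_def frob_sub_poset_def)
    then obtain S where "S \<in> ?S" "a = sub_equiv C X `` {S}" by (auto elim: quotientE)
    then show "a \<in> (\<lambda>b. {T \<in> ?S. sub_idem C X T = b}) ` (sub_idem C X ` ?S)"
      by (intro image_eqI[OF _ imageI]) (auto simp: sub_equiv_def)
  qed
  ultimately show ?thesis by (rule finite_subset[rotated, OF finite_imageI])
qed

end
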